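(* Let $p$ be a prime. For every $\varepsilon>0$ there exist a pro-$p$ group $G_\varepsilon$ and an element $x\in G_\varepsilon$ such that $0<\mu(\mathbb{O}_x)<\varepsilon$.
   Context: For a profinite group $G$ and $x\in G$, the openizer of $x$ is $\mathbb{O}_x=\{y\in G\mid \langle x,y\rangle\text{ is open in }G\}$, where $\langle x,y\rangle$ is the closed subgroup topologically generated by $x$ and $y$. $\mu$ denotes the normalised Haar measure on $G$, $\mu(G)=1$. *)

theory Defs
  imports "HOL-Algebra.Generated_Groups" "HOL-Probability.Probability"
begin

locale topological_group = group G
  for G :: "('a, 'b) monoid_scheme" (structure) and T :: "'a topology" +
  assumes topspace_eq: "topspace T = carrier G"
    and continuous_mult: "continuous_map (prod_topology T T) T (\<lambda>(a, b). a \<otimes> b)"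
    and continuous_inv: "continuous_map T T (\<lambda>a. inv a)"

locale profinite_group = topological_group +
  assumes compact: "compact_space T"
    and hausdorff: "Hausdorff_space T"
    and totally_disconnected: "connectedin T S \<Longrightarrow> \<exists>a. S \<subseteq> {a}"

locale pro_p_group = profinite_group +
  fixes p :: nat
  assumes prime_p: "prime p"
    and index_open_normal: "\<lbrakk>N \<lhd> G; openin T N\<rbrakk> \<Longrightarrow> \<exists>k. card (rcosets N) = p ^ k"

text \<open>The normalised Haar measure, as a left-invariant Radon probability measure on the Borel sets
  of the topology. On a compact Hausdorff group there is exactly one such measure.\<close>

definition normalised_haar_measure ::
    "('a, 'b) monoid_scheme \<Rightarrow> 'a topology \<Rightarrow> 'a measure \<Rightarrow> bool" where
  "normalised_haar_measure G T M \<longleftrightarrow>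
     prob_space M \<and>
     space M = topspace T \<and>
     sets M = sigma_sets (topspace T) {U. openin T U} \<and>
     (\<forall>g\<in>carrier G. \<forall>B\<in>sets M. emeasure M ((\<lambda>h. g \<otimes>\<^bsub>G\<^esub> h) ` B) = emeasure M B) \<and>
     (\<forall>B\<in>sets M. emeasure M B = (INF U\<in>{U. openin T U \<and> B \<subseteq> U}. emeasure M U)) \<and>
     (\<forall>U. openin T U \<longrightarrow>
        emeasure M U = (SUP K\<in>{K. compactin T K \<and> K \<in> sets M \<and> K \<subseteq> U}. emeasure M K))"

definition closed_generate ::
    "('a, 'b) monoid_scheme \<Rightarrow> 'a topology \<Rightarrow> 'a set \<Rightarrow> 'a set" where
  "closed_generate G T S = T closure_of (generate G S)"

definition openizer :: "('a, 'b) monoid_scheme \<Rightarrow> 'a topology \<Rightarrow> 'a \<Rightarrow> 'a set" where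
  "openizer G T x = {y \<in> carrier G. openin T (closed_generate G T {x, y})}"

text \<open>Existence statements about groups must fix a carrier type, for which \<^typ>\<open>nat \<Rightarrow> int\<close> is
  large enough: a profinite group in which some openizer is nonempty is topologically finitely
  generated, hence has at most continuum many elements. In such a group openizers are Borel sets, so
  taking their \<^const>\<open>measure\<close> does not hit the default value for non-measurable sets.\<close>

end

theory Submission
  imports Defs "HOL-Number_Theory.Cong"
begin

text \<open>Let \<open>A\<^sub>i\<close> be the integer functions on \<open>\<int>/p\<^bsup>i+3\<^esup>\<close> modulo those of period \<open>p\<^bsup>i+2\<^esup>\<close>, a lattice
  on which the shift acts with the primitive \<open>p\<^bsup>i+3\<^esup>\<close>-th roots of unity as eigenvalues. Let \<open>G\<close> be the
  pro-\<open>p\<close> completion of \<open>\<Oplus>\<^bsub>i<k\<^esub> A\<^sub>i\<close> extended by a finite group \<open>(\<int>/p\<^bsup>k+2\<^esup>)\<^bsup>k\<^esup>\<close>, whose \<open>i\<close>-th coordinate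
  shifts \<open>A\<^sub>i\<close>, and let \<open>x\<close> be the tuple of delta functions. If \<open>y\<close> lies over \<open>(t\<^sub>0, \<dots>, t\<^bsub>k-1\<^esub>)\<close> with
  all \<open>t\<^sub>i\<close> prime to \<open>p\<close>, then \<open>y\<close> generates each shift group, and as the eigenvalues on distinct \<open>A\<^sub>i\<close>
  are distinct, the conjugates of \<open>x\<close> under \<open>y\<close> span a sublattice of finite index, so \<open>\<langle>x, y\<rangle>\<close> is open.
  If \<open>p\<close> divides some \<open>t\<^sub>i\<close>, then on the residue class of \<open>1\<close> modulo \<open>p\<close> the \<open>i\<close>-th component of \<open>\<langle>x, y\<rangle>\<close> sees
  only the powers of \<open>y\<close> and has rank at most one there, so \<open>\<langle>x, y\<rangle>\<close> is not open. Hence the openizer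
  of \<open>x\<close> has measure \<open>(1 - 1/p)\<^sup>k\<close>.\<close>

section \<open>Completion of a group along a digit expansion\<close>

text \<open>Agreement of the first \<open>n\<close> digits is a congruence on \<open>\<Gamma>\<close>, so the digit sequences form the inverse
  limit of the quotients. No separatedness is required: \<open>\<Gamma>\<close> need not embed into the limit.\<close>

locale digit_filtration = group \<Gamma> for \<Gamma> :: "'a monoid" (structure) +
  fixes D :: "nat \<Rightarrow> 'a \<Rightarrow> int" and B :: "nat \<Rightarrow> int set" and p :: nat
  assumes prime: "prime p"
    and card_B: "\<exists>e. card (B n) = p ^ e"
    and D_in: "x \<in> carrier \<Gamma> \<Longrightarrow> D n x \<in> B n"
    and D_mult: "\<lbrakk>x \<in> carrier \<Gamma>; x' \<in> carrier \<Gamma>; y \<in> carrier \<Gamma>; y' \<in> carrier \<Gamma>;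
        \<forall>i<n. D i x = D i x'; \<forall>i<n. D i y = D i y'\<rbrakk> \<Longrightarrow> \<forall>i<n. D i (x \<otimes> y) = D i (x' \<otimes> y')"
    and D_surj: "\<forall>i. s i \<in> B i \<Longrightarrow> \<exists>x\<in>carrier \<Gamma>. \<forall>i<n. D i x = s i"
begin

section \<open>The group of digit sequences\<close>

definition digits :: "'a \<Rightarrow> nat \<Rightarrow> int" where
  "digits x = (\<lambda>i. D i x)"

definition seqs :: "(nat \<Rightarrow> int) set" where
  "seqs = {s. \<forall>i. s i \<in> B i}"

definition agree :: "nat \<Rightarrow> (nat \<Rightarrow> int) \<Rightarrow> (nat \<Rightarrow> int) \<Rightarrow> bool" where
  "agree n s t \<longleftrightarrow> (\<forall>i<n. s i = t i)"

definition rep :: "nat \<Rightarrow> (nat \<Rightarrow> int) \<Rightarrow> 'a" where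
  "rep n s = (SOME x. x \<in> carrier \<Gamma> \<and> agree n (digits x) s)"

text \<open>Digit \<open>i\<close> of a product depends only on the digits up to \<open>i\<close> of
  the factors, so representatives correct to \<open>Suc i\<close> digits suffice and the choice made
  in \<open>rep\<close> is immaterial.\<close>

definition cgroup :: "(nat \<Rightarrow> int) monoid" where
  "cgroup = \<lparr>carrier = seqs,
     monoid.mult = (\<lambda>s t. \<lambda>i. D i (rep (Suc i) s \<otimes> rep (Suc i) t)),
     one = digits \<one>\<rparr>"

definition ctop :: "(nat \<Rightarrow> int) topology" where
  "ctop = product_topology (\<lambda>i. discrete_topology (B i)) UNIV"

text \<open>This is the Haar measure: left translations permute the cylinders of each length, and
  these all have equal measure.\<close>

definition cmeas :: "(nat \<Rightarrow> int) measure" where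
  "cmeas = PiM UNIV (\<lambda>i. uniform_count_measure (B i))"

text \<open>A power of \<open>p\<close> is nonzero, whereas \<open>card\<close> is zero on the empty
  set and, by default, on infinite sets.\<close>

lemma finite_B: "finite (B n)" and B_nonempty: "B n \<noteq> {}"
  using card_B[of n] prime by (auto intro!: card_ge_0_finite simp: prime_gt_0_nat)

lemma agree_refl [simp]: "agree n s s"
  and agree_sym: "agree n s t \<Longrightarrow> agree n t s"
  and agree_trans: "agree n s t \<Longrightarrow> agree n t u \<Longrightarrow> agree n s u"
  and agree_mono: "agree n s t \<Longrightarrow> m \<le> n \<Longrightarrow> agree m s t"
  and agree_0 [simp]: "agree 0 s t"
  by (auto simp: agree_def)

lemma agreeI: "(\<And>n. agree n s t) \<Longrightarrow> s = t"
  by (auto simp: agree_def fun_eq_iff)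

lemma digits_in: "x \<in> carrier \<Gamma> \<Longrightarrow> digits x \<in> seqs"
  by (simp add: digits_def seqs_def D_in)

lemma ex_rep: "s \<in> seqs \<Longrightarrow> \<exists>x\<in>carrier \<Gamma>. agree n (digits x) s"
  using D_surj[of s n] by (auto simp: seqs_def agree_def digits_def)

lemma rep: assumes "s \<in> seqs"
  shows rep_in: "rep n s \<in> carrier \<Gamma>" and agree_rep: "agree n (digits (rep n s)) s"
  using someI_ex[of "\<lambda>x. x \<in> carrier \<Gamma> \<and> agree n (digits x) s"] ex_rep[OF assms, of n]
  unfolding rep_def by blast+

lemma agree_digits_mult:
  "\<lbrakk>x \<in> carrier \<Gamma>; x' \<in> carrier \<Gamma>; y \<in> carrier \<Gamma>; y' \<in> carrier \<Gamma>;
    agree n (digits x) (digits x'); agree n (digits y) (digits y')\<rbrakk>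
   \<Longrightarrow> agree n (digits (x \<otimes> y)) (digits (x' \<otimes> y'))"
  unfolding agree_def digits_def by (rule D_mult)

text \<open>\<open>D_mult\<close> speaks of products only. Exchanging \<open>x'\<close> for
  \<open>x\<close> in \<open>inv x \<otimes> (x' \<otimes> inv x')\<close> turns
  \<open>inv x\<close> into \<open>inv x'\<close>.\<close>

lemma agree_digits_inv:
  assumes "x \<in> carrier \<Gamma>" "x' \<in> carrier \<Gamma>" "agree n (digits x) (digits x')"
  shows "agree n (digits (inv x)) (digits (inv x'))"
proof -
  have "agree n (digits (inv x \<otimes> (x' \<otimes> inv x'))) (digits (inv x \<otimes> (x \<otimes> inv x')))"
    using assms by (intro agree_digits_mult agree_sym[OF assms(3)]) auto
  moreover have "inv x \<otimes> (x \<otimes> inv x') = inv x'"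
    using assms by (simp add: m_assoc[symmetric])
  ultimately show ?thesis
    using assms by simp
qed

lemma carrier_cgroup [simp]: "carrier cgroup = seqs"
  by (simp add: cgroup_def)

lemma one_cgroup: "\<one>\<^bsub>cgroup\<^esub> = digits \<one>"
  by (simp add: cgroup_def)

text \<open>The bridge to \<open>\<Gamma>\<close>: arbitrary representatives correct to
  \<open>n\<close> digits compute a product to \<open>n\<close> digits. The group laws are inherited
  through it, level by level.\<close>

lemma agree_mult:
  assumes "s \<in> seqs" "t \<in> seqs" "x \<in> carrier \<Gamma>" "y \<in> carrier \<Gamma>"
    "agree n (digits x) s" "agree n (digits y) t"
  shows "agree n (s \<otimes>\<^bsub>cgroup\<^esub> t) (digits (x \<otimes> y))"
  unfolding agree_def
proof (intro allI impI)
  fix i assume "i < n"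
  hence "agree (Suc i) (digits x) s" "agree (Suc i) (digits y) t"
    using assms(5,6) by (auto intro: agree_mono)
  hence "agree (Suc i) (digits (rep (Suc i) s \<otimes> rep (Suc i) t)) (digits (x \<otimes> y))"
    using assms by (intro agree_digits_mult rep_in) (blast intro: agree_trans agree_sym agree_rep)+
  thus "(s \<otimes>\<^bsub>cgroup\<^esub> t) i = digits (x \<otimes> y) i"
    by (simp add: agree_def cgroup_def digits_def)
qed

lemma mult_in: "s \<in> seqs \<Longrightarrow> t \<in> seqs \<Longrightarrow> s \<otimes>\<^bsub>cgroup\<^esub> t \<in> seqs"
  using D_in rep_in by (auto simp: cgroup_def seqs_def)

lemma agree_mult_cong:
  assumes "s \<in> seqs" "s' \<in> seqs" "t \<in> seqs" "t' \<in> seqs" "agree n s s'" "agree n t t'"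
  shows "agree n (s \<otimes>\<^bsub>cgroup\<^esub> t) (s' \<otimes>\<^bsub>cgroup\<^esub> t')"
proof -
  have "agree n (digits (rep n s)) s'" "agree n (digits (rep n t)) t'"
    using assms agree_rep agree_trans by blast+
  hence "agree n (s' \<otimes>\<^bsub>cgroup\<^esub> t') (digits (rep n s \<otimes> rep n t))"
    using assms by (intro agree_mult rep_in)
  moreover have "agree n (s \<otimes>\<^bsub>cgroup\<^esub> t) (digits (rep n s \<otimes> rep n t))"
    using assms by (intro agree_mult rep)
  ultimately show ?thesis
    using agree_trans agree_sym by blast
qed

lemma digits_mult:
  "x \<in> carrier \<Gamma> \<Longrightarrow> y \<in> carrier \<Gamma> \<Longrightarrow> digits x \<otimes>\<^bsub>cgroup\<^esub> digits y = digits (x \<otimes> y)"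
  by (rule agreeI, rule agree_mult) (auto simp: digits_in)

lemma group_cgroup: "group cgroup"
proof (rule groupI; simp only: carrier_cgroup)
  fix s t u assume s: "s \<in> seqs" and t: "t \<in> seqs" and u: "u \<in> seqs"
  show "s \<otimes>\<^bsub>cgroup\<^esub> t \<in> seqs"
    using s t by (rule mult_in)
  show "s \<otimes>\<^bsub>cgroup\<^esub> t \<otimes>\<^bsub>cgroup\<^esub> u = s \<otimes>\<^bsub>cgroup\<^esub> (t \<otimes>\<^bsub>cgroup\<^esub> u)"
  proof (rule agreeI)
    fix n
    have *: "rep n s \<in> carrier \<Gamma>" "rep n t \<in> carrier \<Gamma>" "rep n u \<in> carrier \<Gamma>"
      using s t u by (auto intro: rep_in)
    have "agree n (s \<otimes>\<^bsub>cgroup\<^esub> t \<otimes>\<^bsub>cgroup\<^esub> u) (digits (rep n s \<otimes> rep n t \<otimes> rep n u))"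
      using s t u * by (intro agree_mult mult_in agree_sym[OF agree_mult] agree_rep) auto
    moreover have "agree n (s \<otimes>\<^bsub>cgroup\<^esub> (t \<otimes>\<^bsub>cgroup\<^esub> u)) (digits (rep n s \<otimes> rep n t \<otimes> rep n u))"
      unfolding m_assoc[OF *] using s t u * by (intro agree_mult mult_in agree_sym[OF agree_mult] agree_rep) auto
    ultimately show "agree n (s \<otimes>\<^bsub>cgroup\<^esub> t \<otimes>\<^bsub>cgroup\<^esub> u) (s \<otimes>\<^bsub>cgroup\<^esub> (t \<otimes>\<^bsub>cgroup\<^esub> u))"
      by (rule agree_trans[OF _ agree_sym])
  qed
next
  show "\<one>\<^bsub>cgroup\<^esub> \<in> seqs"
    by (simp add: one_cgroup digits_in)
next
  fix s assume s: "s \<in> seqs"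
  show "\<one>\<^bsub>cgroup\<^esub> \<otimes>\<^bsub>cgroup\<^esub> s = s"
  proof (rule agreeI)
    fix n
    have "agree n (\<one>\<^bsub>cgroup\<^esub> \<otimes>\<^bsub>cgroup\<^esub> s) (digits (\<one> \<otimes> rep n s))"
      unfolding one_cgroup using s by (intro agree_mult rep digits_in) auto
    thus "agree n (\<one>\<^bsub>cgroup\<^esub> \<otimes>\<^bsub>cgroup\<^esub> s) s"
      using agree_rep[OF s, of n] rep_in[OF s, of n] agree_trans by simp
  qed
  \<comment> \<open>As for products, each digit comes from its own representative;
    \<open>agree_digits_inv\<close> shows that these choices fit together.\<close>
  define t where "t = (\<lambda>i. D i (inv (rep (Suc i) s)))"
  have t: "t \<in> seqs"
    using s by (auto simp: t_def seqs_def intro!: D_in rep_in)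
  have "t \<otimes>\<^bsub>cgroup\<^esub> s = \<one>\<^bsub>cgroup\<^esub>"
  proof (rule agreeI)
    fix n
    have r: "rep n s \<in> carrier \<Gamma>" "agree n (digits (rep n s)) s"
      using s rep by auto
    have "agree n (digits (inv (rep n s))) t"
      unfolding agree_def
    proof (intro allI impI)
      fix i assume i: "i < n"
      hence "agree (Suc i) (digits (rep n s)) (digits (rep (Suc i) s))"
        using r agree_rep[OF s, of "Suc i"] agree_mono agree_trans agree_sym by (metis Suc_leI)
      hence "agree (Suc i) (digits (inv (rep n s))) (digits (inv (rep (Suc i) s)))"
        using s by (intro agree_digits_inv rep_in)
      thus "digits (inv (rep n s)) i = t i"
        by (simp add: agree_def t_def digits_def)
    qed
    hence "agree n (t \<otimes>\<^bsub>cgroup\<^esub> s) (digits (inv (rep n s) \<otimes> rep n s))"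
      using s t r by (intro agree_mult) auto
    thus "agree n (t \<otimes>\<^bsub>cgroup\<^esub> s) \<one>\<^bsub>cgroup\<^esub>"
      using r by (simp add: one_cgroup)
  qed
  thus "\<exists>t\<in>seqs. t \<otimes>\<^bsub>cgroup\<^esub> s = \<one>\<^bsub>cgroup\<^esub>"
    using t by blast
qed

sublocale C: group cgroup
  rewrites "carrier cgroup = seqs"
  by (rule group_cgroup) simp

text \<open>To \<open>n\<close> digits, \<open>x\<close> may be replaced by \<open>s\<close> in the
  product of \<open>inv s\<close>, \<open>x\<close> and \<open>inv x\<close>. One reading collapses
  to \<open>inv s\<close>, the other to \<open>digits (inv x)\<close>.\<close>

lemma agree_inv:
  assumes "s \<in> seqs" "x \<in> carrier \<Gamma>" "agree n (digits x) s"
  shows "agree n (inv\<^bsub>cgroup\<^esub> s) (digits (inv x))"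
proof -
  have "agree n (inv\<^bsub>cgroup\<^esub> s \<otimes>\<^bsub>cgroup\<^esub> (digits x \<otimes>\<^bsub>cgroup\<^esub> digits (inv x)))
                (inv\<^bsub>cgroup\<^esub> s \<otimes>\<^bsub>cgroup\<^esub> (s \<otimes>\<^bsub>cgroup\<^esub> digits (inv x)))"
    using assms digits_in by (intro agree_mult_cong) (auto simp: mult_in)
  moreover have "digits x \<otimes>\<^bsub>cgroup\<^esub> digits (inv x) = \<one>\<^bsub>cgroup\<^esub>"
    using assms by (simp add: digits_mult one_cgroup)
  moreover have "inv\<^bsub>cgroup\<^esub> s \<otimes>\<^bsub>cgroup\<^esub> (s \<otimes>\<^bsub>cgroup\<^esub> digits (inv x)) = digits (inv x)"
    using assms digits_in by (simp add: C.m_assoc[symmetric])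
  ultimately show ?thesis
    using assms by simp
qed

lemma agree_inv_cong:
  assumes "s \<in> seqs" "t \<in> seqs" "agree n s t"
  shows "agree n (inv\<^bsub>cgroup\<^esub> s) (inv\<^bsub>cgroup\<^esub> t)"
proof -
  have "agree n (digits (rep n s)) t"
    using agree_trans[OF agree_rep assms(3)] assms(1) .
  thus ?thesis
    using agree_trans[OF agree_inv agree_sym[OF agree_inv]] assms rep by metis
qed

section \<open>The profinite topology\<close>

lemma topspace_ctop: "topspace ctop = seqs"
  by (auto simp: ctop_def seqs_def)

text \<open>A basic open set of the product constrains finitely many coordinates, hence only
  coordinates below some \<open>n\<close>. From here on the topology is handled through agreement of
  prefixes.\<close>

lemma openin_ctop:
  "openin ctop U \<longleftrightarrow> U \<subseteq> seqs \<and> (\<forall>s\<in>U. \<exists>n. \<forall>t\<in>seqs. agree n s t \<longrightarrow> t \<in> U)"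
proof
  assume U: "openin ctop U"
  show "U \<subseteq> seqs \<and> (\<forall>s\<in>U. \<exists>n. \<forall>t\<in>seqs. agree n s t \<longrightarrow> t \<in> U)"
  proof (intro conjI ballI)
    show "U \<subseteq> seqs"
      using openin_subset[OF U] by (simp add: topspace_ctop)
    fix s assume "s \<in> U"
    then obtain V where V: "finite {i. V i \<noteq> B i}" "s \<in> Pi\<^sub>E UNIV V" "Pi\<^sub>E UNIV V \<subseteq> U"
      using U unfolding ctop_def openin_product_topology_alt by auto
    obtain n where n: "\<And>i. V i \<noteq> B i \<Longrightarrow> i < n"
      using finite_nat_set_iff_bounded V(1) by auto
    have "t \<in> U" if "t \<in> seqs" "agree n s t" for t
    proof -
      have "t i \<in> V i" for i
      proof (cases "i < n")
        case True
        hence "t i = s i" using that by (simp add: agree_def)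
        thus ?thesis using V(2) by (simp add: PiE_iff)
      next
        case False
        hence "V i = B i" using n by blast
        thus ?thesis using that by (simp add: seqs_def)
      qed
      thus ?thesis using V(3) by auto
    qed
    thus "\<exists>n. \<forall>t\<in>seqs. agree n s t \<longrightarrow> t \<in> U" by blast
  qed
next
  assume *: "U \<subseteq> seqs \<and> (\<forall>s\<in>U. \<exists>n. \<forall>t\<in>seqs. agree n s t \<longrightarrow> t \<in> U)"
  show "openin ctop U"
    unfolding ctop_def openin_product_topology_alt
  proof
    fix s assume "s \<in> U"
    then obtain n where n: "\<forall>t\<in>seqs. agree n s t \<longrightarrow> t \<in> U" using * by blast
    define V where "V = (\<lambda>i. if i < n then {s i} else B i)"
    have s: "s i \<in> B i" for i
      using \<open>s \<in> U\<close> * by (auto simp: seqs_def)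
    have "finite {i. V i \<noteq> B i}"
      by (rule finite_subset[of _ "{..<n}"]) (auto simp: V_def)
    moreover have "s \<in> Pi\<^sub>E UNIV V"
      using s by (auto simp: V_def)
    moreover have "Pi\<^sub>E UNIV V \<subseteq> U"
    proof
      fix t assume "t \<in> Pi\<^sub>E UNIV V"
      hence t: "t i \<in> V i" for i by auto
      have "t i \<in> B i" for i using t[of i] s[of i] by (auto simp: V_def split: if_splits)
      moreover have "s i = t i" if "i < n" for i using t[of i] that by (auto simp: V_def)
      ultimately show "t \<in> U" using n by (auto simp: seqs_def agree_def)
    qed
    ultimately show "\<exists>U'. finite {i \<in> UNIV. U' i \<noteq> topspace (discrete_topology (B i))} \<and>
        (\<forall>i\<in>UNIV. openin (discrete_topology (B i)) (U' i)) \<and> s \<in> Pi\<^sub>E UNIV U' \<and> Pi\<^sub>E UNIV U' \<subseteq> U"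
      using s by (intro exI[of _ V]) (auto simp: V_def)
  qed
qed

lemma openin_ctopE:
  assumes "openin ctop U" "s \<in> U"
  obtains n where "\<And>t. t \<in> seqs \<Longrightarrow> agree n s t \<Longrightarrow> t \<in> U"
  using assms unfolding openin_ctop by blast

text \<open>The property passes to complements, so these sets are open and closed, hence
  compact.\<close>

definition level_set :: "nat \<Rightarrow> (nat \<Rightarrow> int) set \<Rightarrow> bool" where
  "level_set n A \<longleftrightarrow> A \<subseteq> seqs \<and> (\<forall>s\<in>A. \<forall>t\<in>seqs. agree n s t \<longrightarrow> t \<in> A)"

lemma level_set_openin: "level_set n A \<Longrightarrow> openin ctop A"
  by (auto simp: level_set_def openin_ctop)

lemma level_set_Diff: "level_set n A \<Longrightarrow> level_set n (seqs - A)"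
  using agree_sym by (auto simp: level_set_def)

lemma level_set_closedin: "level_set n A \<Longrightarrow> closedin ctop A"
  using level_set_openin[OF level_set_Diff] by (auto simp: closedin_def topspace_ctop level_set_def)

lemma compact_ctop: "compact_space ctop"
  by (auto simp: ctop_def compact_space_product_topology compact_space_discrete_topology finite_B)

lemma level_set_compactin: "level_set n A \<Longrightarrow> compactin ctop A"
  using compact_ctop level_set_closedin closedin_compact_space by blast

definition cyl :: "nat \<Rightarrow> (nat \<Rightarrow> int) \<Rightarrow> (nat \<Rightarrow> int) set" where
  "cyl n s = {t \<in> seqs. agree n s t}"

lemma level_set_cyl: "level_set n (cyl n s)"
  by (auto simp: level_set_def cyl_def intro: agree_trans)

lemma topological_group_cgroup: "topological_group cgroup ctop"
proof (intro topological_group.intro topological_group_axioms.intro group_cgroup)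
  show "topspace ctop = carrier cgroup"
    by (simp add: topspace_ctop)
  show "continuous_map (prod_topology ctop ctop) ctop (\<lambda>(a, b). a \<otimes>\<^bsub>cgroup\<^esub> b)"
    unfolding continuous_map_def
  proof (intro conjI allI impI)
    show "(\<lambda>(a, b). a \<otimes>\<^bsub>cgroup\<^esub> b) \<in> topspace (prod_topology ctop ctop) \<rightarrow> topspace ctop"
      by (auto simp: topspace_ctop mult_in)
    fix U assume U: "openin ctop U"
    show "openin (prod_topology ctop ctop)
        {x \<in> topspace (prod_topology ctop ctop). (case x of (a, b) \<Rightarrow> a \<otimes>\<^bsub>cgroup\<^esub> b) \<in> U}"
      unfolding openin_prod_topology_alt
    proof (intro allI impI)
      fix s t
      assume st: "(s, t) \<in> {x \<in> topspace (prod_topology ctop ctop). (case x of (a, b) \<Rightarrow> a \<otimes>\<^bsub>cgroup\<^esub> b) \<in> U}"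
      then obtain n where n: "\<And>u. u \<in> seqs \<Longrightarrow> agree n (s \<otimes>\<^bsub>cgroup\<^esub> t) u \<Longrightarrow> u \<in> U"
        using U openin_ctopE[OF U, of "s \<otimes>\<^bsub>cgroup\<^esub> t"] by auto
      have "s \<in> seqs" "t \<in> seqs" using st by (auto simp: topspace_ctop)
      moreover have "a \<otimes>\<^bsub>cgroup\<^esub> b \<in> U" if "a \<in> seqs" "agree n s a" "b \<in> seqs" "agree n t b" for a b
        using that \<open>s \<in> seqs\<close> \<open>t \<in> seqs\<close> by (intro n mult_in agree_mult_cong)
      ultimately show "\<exists>V W. openin ctop V \<and> openin ctop W \<and> s \<in> V \<and> t \<in> W \<and>
         V \<times> W \<subseteq> {x \<in> topspace (prod_topology ctop ctop). (case x of (a, b) \<Rightarrow> a \<otimes>\<^bsub>cgroup\<^esub> b) \<in> U}"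
        using level_set_openin[OF level_set_cyl, of n]
        by (intro exI[of _ "cyl n s"] exI[of _ "cyl n t"]) (auto simp: topspace_ctop cyl_def)
    qed
  qed
  show "continuous_map ctop ctop (\<lambda>a. inv\<^bsub>cgroup\<^esub> a)"
    unfolding continuous_map_def
  proof (intro conjI allI impI)
    show "(\<lambda>a. inv\<^bsub>cgroup\<^esub> a) \<in> topspace ctop \<rightarrow> topspace ctop"
      by (auto simp: topspace_ctop)
    fix U assume U: "openin ctop U"
    show "openin ctop {x \<in> topspace ctop. inv\<^bsub>cgroup\<^esub> x \<in> U}"
      unfolding openin_ctop topspace_ctop
    proof (intro conjI ballI)
      fix s assume "s \<in> {x \<in> seqs. inv\<^bsub>cgroup\<^esub> x \<in> U}"
      hence s: "s \<in> seqs" "inv\<^bsub>cgroup\<^esub> s \<in> U" by auto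
      obtain n where "\<And>t. t \<in> seqs \<Longrightarrow> agree n (inv\<^bsub>cgroup\<^esub> s) t \<Longrightarrow> t \<in> U"
        using openin_ctopE[OF U s(2)] by blast
      thus "\<exists>n. \<forall>t\<in>seqs. agree n s t \<longrightarrow> t \<in> {x \<in> seqs. inv\<^bsub>cgroup\<^esub> x \<in> U}"
        using agree_inv_cong[OF s(1)] by (intro exI[of _ n]) simp
    qed auto
  qed
qed

lemma profinite_group_cgroup: "profinite_group cgroup ctop"
proof (intro profinite_group.intro profinite_group_axioms.intro topological_group_cgroup compact_ctop)
  show "Hausdorff_space ctop"
    by (simp add: ctop_def Hausdorff_space_product_topology)
  fix S assume S: "connectedin ctop S"
  \<comment> \<open>Each coordinate maps a connected set to a connected subset of a discrete space,
    that is, to at most one point.\<close>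
  have "\<exists>a. (\<lambda>s. s i) ` S \<subseteq> {a}" for i
  proof -
    have "continuous_map ctop (discrete_topology (B i)) (\<lambda>s. s i)"
      unfolding ctop_def by (rule continuous_map_product_projection) simp
    hence "connectedin (discrete_topology (B i)) ((\<lambda>s. s i) ` S)"
      using S connectedin_continuous_map_image by blast
    thus ?thesis by (simp add: connectedin_discrete_topology)
  qed
  then obtain a where a: "\<And>i. (\<lambda>s. s i) ` S \<subseteq> {a i}" by metis
  hence "S \<subseteq> {a}" by (auto simp: fun_eq_iff image_subset_iff)
  thus "\<exists>a. S \<subseteq> {a}" by blast
qed

section \<open>Prefixes and the index of open subgroups\<close>

definition trunc :: "nat \<Rightarrow> (nat \<Rightarrow> int) \<Rightarrow> nat \<Rightarrow> int" where
  "trunc n s = restrict s {..<n}"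

lemma trunc_eq_iff: "trunc n s = trunc n t \<longleftrightarrow> agree n s t"
  by (auto simp: trunc_def agree_def restrict_def fun_eq_iff)

lemma trunc_seqs: "trunc n ` seqs = Pi\<^sub>E {..<n} B"
proof
  show "trunc n ` seqs \<subseteq> Pi\<^sub>E {..<n} B"
    by (auto simp: trunc_def seqs_def PiE_iff split: if_splits)
  show "Pi\<^sub>E {..<n} B \<subseteq> trunc n ` seqs"
  proof
    fix u assume u: "u \<in> Pi\<^sub>E {..<n} B"
    obtain b where b: "\<And>i. b i \<in> B i"
      using B_nonempty by (atomize_elim, intro choice) auto
    have "u = trunc n (\<lambda>i. if i < n then u i else b i)"
      using u by (auto simp: trunc_def fun_eq_iff PiE_iff extensional_def)
    moreover have "(\<lambda>i. if i < n then u i else b i) \<in> seqs"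
      using u b by (auto simp: seqs_def PiE_iff)
    ultimately show "u \<in> trunc n ` seqs" by blast
  qed
qed

lemma finite_trunc: "finite (trunc n ` seqs)"
  by (simp add: trunc_seqs finite_PiE finite_B)

lemma card_trunc: "\<exists>e. card (trunc n ` seqs) = p ^ e"
proof -
  obtain e where "\<And>i. card (B i) = p ^ e i" using card_B by metis
  thus ?thesis by (auto simp: trunc_seqs card_PiE power_sum[symmetric])
qed

text \<open>An open subgroup contains all sequences agreeing with the identity to some
  \<open>n\<close> digits, so its cosets are decided by prefixes of length \<open>n\<close>.
  Truncation turns them into disjoint sets of equal size that partition the set of prefixes, whose
  cardinality is a power of \<open>p\<close>; the index divides that power.\<close>

lemma index_open_subgroup:
  assumes N: "subgroup N cgroup" and "openin ctop N"
  shows "\<exists>k. card (rcosets\<^bsub>cgroup\<^esub> N) = p ^ k"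
proof -
  interpret N: subgroup N cgroup by fact
  have N_sub: "N \<subseteq> seqs" using N.subset by simp
  obtain n where n: "\<And>t. t \<in> seqs \<Longrightarrow> agree n \<one>\<^bsub>cgroup\<^esub> t \<Longrightarrow> t \<in> N"
    using openin_ctopE[OF assms(2) N.one_closed] by blast
  have coset_iff: "t \<in> N #>\<^bsub>cgroup\<^esub> s \<longleftrightarrow> t \<in> seqs \<and> t \<otimes>\<^bsub>cgroup\<^esub> inv\<^bsub>cgroup\<^esub> s \<in> N"
    if "s \<in> seqs" for s t
  proof
    assume "t \<in> N #>\<^bsub>cgroup\<^esub> s"
    then obtain h where h: "h \<in> N" "t = h \<otimes>\<^bsub>cgroup\<^esub> s" by (auto simp: r_coset_def)
    hence "h \<in> seqs" using N_sub by blast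
    thus "t \<in> seqs \<and> t \<otimes>\<^bsub>cgroup\<^esub> inv\<^bsub>cgroup\<^esub> s \<in> N"
      using h that by (simp add: mult_in C.m_assoc)
  next
    assume "t \<in> seqs \<and> t \<otimes>\<^bsub>cgroup\<^esub> inv\<^bsub>cgroup\<^esub> s \<in> N"
    moreover from this have "t = (t \<otimes>\<^bsub>cgroup\<^esub> inv\<^bsub>cgroup\<^esub> s) \<otimes>\<^bsub>cgroup\<^esub> s"
      using that by (simp add: C.m_assoc)
    ultimately show "t \<in> N #>\<^bsub>cgroup\<^esub> s"
      unfolding r_coset_def by blast
  qed
  \<comment> \<open>The product of \<open>t\<close> and the inverse of \<open>u\<close> agrees with
    the identity to \<open>n\<close> digits and so lies in \<open>N\<close>.\<close>
  have closed: "t \<in> N #>\<^bsub>cgroup\<^esub> s" if "s \<in> seqs" "u \<in> N #>\<^bsub>cgroup\<^esub> s" "agree n u t" "t \<in> seqs" for s t u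
  proof -
    have u: "u \<in> seqs" "u \<otimes>\<^bsub>cgroup\<^esub> inv\<^bsub>cgroup\<^esub> s \<in> N" using that coset_iff by auto
    have "agree n (u \<otimes>\<^bsub>cgroup\<^esub> inv\<^bsub>cgroup\<^esub> u) (t \<otimes>\<^bsub>cgroup\<^esub> inv\<^bsub>cgroup\<^esub> u)"
      using that u by (intro agree_mult_cong) auto
    hence "t \<otimes>\<^bsub>cgroup\<^esub> inv\<^bsub>cgroup\<^esub> u \<in> N"
      using that u n mult_in by simp
    hence "(t \<otimes>\<^bsub>cgroup\<^esub> inv\<^bsub>cgroup\<^esub> u) \<otimes>\<^bsub>cgroup\<^esub> (u \<otimes>\<^bsub>cgroup\<^esub> inv\<^bsub>cgroup\<^esub> s) \<in> N"
      using u by simp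
    also have "(t \<otimes>\<^bsub>cgroup\<^esub> inv\<^bsub>cgroup\<^esub> u) \<otimes>\<^bsub>cgroup\<^esub> (u \<otimes>\<^bsub>cgroup\<^esub> inv\<^bsub>cgroup\<^esub> s)
        = t \<otimes>\<^bsub>cgroup\<^esub> inv\<^bsub>cgroup\<^esub> s"
      using u that by (simp add: C.m_assoc mult_in C.m_assoc[symmetric, of "inv\<^bsub>cgroup\<^esub> u" u])
    finally show ?thesis using that coset_iff by simp
  qed
  have card_eq: "card (trunc n ` X) = card (trunc n ` N)" if "X \<in> rcosets\<^bsub>cgroup\<^esub> N" for X
  proof -
    obtain s where s: "s \<in> seqs" "X = N #>\<^bsub>cgroup\<^esub> s"
      using \<open>X \<in> _\<close> by (auto simp: RCOSETS_def)
    have X: "X = (\<lambda>h. h \<otimes>\<^bsub>cgroup\<^esub> s) ` N"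
      by (auto simp: s r_coset_def)
    have *: "agree n (a \<otimes>\<^bsub>cgroup\<^esub> s) (b \<otimes>\<^bsub>cgroup\<^esub> s) \<longleftrightarrow> agree n a b" if "a \<in> N" "b \<in> N" for a b
    proof
      have ab: "a \<in> seqs" "b \<in> seqs" using that N_sub by auto
      show "agree n (a \<otimes>\<^bsub>cgroup\<^esub> s) (b \<otimes>\<^bsub>cgroup\<^esub> s)" if "agree n a b"
        using ab s that by (intro agree_mult_cong) auto
      assume "agree n (a \<otimes>\<^bsub>cgroup\<^esub> s) (b \<otimes>\<^bsub>cgroup\<^esub> s)"
      hence "agree n (a \<otimes>\<^bsub>cgroup\<^esub> s \<otimes>\<^bsub>cgroup\<^esub> inv\<^bsub>cgroup\<^esub> s) (b \<otimes>\<^bsub>cgroup\<^esub> s \<otimes>\<^bsub>cgroup\<^esub> inv\<^bsub>cgroup\<^esub> s)"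
        using ab s by (intro agree_mult_cong[OF mult_in mult_in]) auto
      thus "agree n a b" using ab s by (simp add: C.m_assoc)
    qed
    \<comment> \<open>Right translation by \<open>s\<close>, read on prefixes. It is well defined
      and injective because translation preserves and reflects agreement to \<open>n\<close>
      digits.\<close>
    define F where "F u = trunc n ((SOME h. h \<in> N \<and> trunc n h = u) \<otimes>\<^bsub>cgroup\<^esub> s)" for u
    have F: "F (trunc n h) = trunc n (h \<otimes>\<^bsub>cgroup\<^esub> s)" if "h \<in> N" for h
    proof -
      have "(SOME h'. h' \<in> N \<and> trunc n h' = trunc n h) \<in> N \<and> trunc n (SOME h'. h' \<in> N \<and> trunc n h' = trunc n h) = trunc n h"
        by (rule someI[of _ h]) (use that in auto)
      thus ?thesis using * that by (simp add: F_def trunc_eq_iff)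
    qed
    have "bij_betw F (trunc n ` N) (trunc n ` X)"
      unfolding bij_betw_def
    proof
      show "inj_on F (trunc n ` N)"
        by (auto simp: inj_on_def F trunc_eq_iff *)
      show "F ` trunc n ` N = trunc n ` X"
        by (auto simp: X F image_image)
    qed
    thus ?thesis by (simp add: bij_betw_same_card)
  qed
  have union: "\<Union> (rcosets\<^bsub>cgroup\<^esub> N) = seqs"
    using C.rcosets_part_G[OF N] by simp
  have disj: "trunc n ` X \<inter> trunc n ` Y = {}"
    if XY: "X \<in> rcosets\<^bsub>cgroup\<^esub> N" "Y \<in> rcosets\<^bsub>cgroup\<^esub> N" "X \<noteq> Y" for X Y
  proof (rule ccontr)
    assume "trunc n ` X \<inter> trunc n ` Y \<noteq> {}"
    then obtain a b where ab: "a \<in> X" "b \<in> Y" "agree n a b" by (auto simp: trunc_eq_iff)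
    have "b \<in> seqs" using ab that union by blast
    moreover obtain s where "s \<in> seqs" "X = N #>\<^bsub>cgroup\<^esub> s"
      using XY by (auto simp: RCOSETS_def)
    ultimately have "b \<in> X" using closed ab by blast
    moreover have "X \<inter> Y = {}"
      using pairwiseD[OF C.rcos_disjoint[OF N] XY] by (simp add: disjnt_def)
    ultimately show False
      using ab by blast
  qed
  have inj: "inj_on ((`) (trunc n)) (rcosets\<^bsub>cgroup\<^esub> N)"
  proof (rule inj_onI, rule ccontr)
    fix X Y assume XY: "X \<in> rcosets\<^bsub>cgroup\<^esub> N" "Y \<in> rcosets\<^bsub>cgroup\<^esub> N" "trunc n ` X = trunc n ` Y" "X \<noteq> Y"
    hence "X = {}" using disj[OF XY(1,2,4)] by auto
    thus False using XY N.rcosets_non_empty by blast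
  qed
  let ?P = "(`) (trunc n) ` (rcosets\<^bsub>cgroup\<^esub> N)"
  have UP: "\<Union> ?P = trunc n ` seqs" using union by blast
  have finP: "finite ?P"
    by (rule finite_UnionD) (simp only: UP finite_trunc)
  have "card (trunc n ` N) * card ?P = card (\<Union> ?P)"
  proof (rule card_partition[OF finP])
    show "finite (\<Union> ?P)" by (simp only: UP finite_trunc)
    show "card X = card (trunc n ` N)" if "X \<in> ?P" for X
      using that card_eq by (elim imageE) simp
    show "X \<inter> Y = {}" if "X \<in> ?P" "Y \<in> ?P" "X \<noteq> Y" for X Y
    proof -
      obtain X' Y' where *: "X' \<in> rcosets\<^bsub>cgroup\<^esub> N" "Y' \<in> rcosets\<^bsub>cgroup\<^esub> N" "X = trunc n ` X'" "Y = trunc n ` Y'"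
        using \<open>X \<in> ?P\<close> \<open>Y \<in> ?P\<close> by (elim imageE)
      hence "X' \<noteq> Y'" using \<open>X \<noteq> Y\<close> by blast
      thus ?thesis using disj * by simp
    qed
  qed
  hence "card (trunc n ` N) * card (rcosets\<^bsub>cgroup\<^esub> N) = card (trunc n ` seqs)"
    by (simp add: UP card_image[OF inj])
  moreover obtain e where "card (trunc n ` seqs) = p ^ e"
    using card_trunc[of n] by blast
  ultimately have "card (rcosets\<^bsub>cgroup\<^esub> N) dvd p ^ e"
    by (metis dvd_triv_right)
  then obtain k where "card (rcosets\<^bsub>cgroup\<^esub> N) = p ^ k"
    by (auto simp: divides_primepow_nat[OF prime])
  thus ?thesis by (rule exI)
qed

lemma pro_p_group_cgroup: "pro_p_group cgroup ctop p"
proof (intro pro_p_group.intro pro_p_group_axioms.intro profinite_group_cgroup prime)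
  fix N assume "N \<lhd> cgroup" "openin ctop N"
  thus "\<exists>k. card (rcosets\<^bsub>cgroup\<^esub> N) = p ^ k"
    by (intro index_open_subgroup normal_imp_subgroup)
qed

section \<open>Cylinders and Borel sets\<close>

definition cyls :: "(nat \<Rightarrow> int) set set" where
  "cyls = insert {} {cyl n s | n s. s \<in> seqs}"

lemma cyls_subset: "cyls \<subseteq> Pow seqs"
  by (auto simp: cyls_def cyl_def)

lemma openin_cyls: "A \<in> cyls \<Longrightarrow> openin ctop A"
  using level_set_openin[OF level_set_cyl] by (auto simp: cyls_def)

lemma closedin_cyls: "A \<in> cyls \<Longrightarrow> closedin ctop A"
  using level_set_closedin[OF level_set_cyl] by (auto simp: cyls_def)

lemma cyl_cong: "agree n s t \<Longrightarrow> cyl n s = cyl n t"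
  by (auto simp: cyl_def intro: agree_trans agree_sym)

text \<open>Two cylinders are nested or disjoint; the second case is why \<open>cyls\<close>
  includes the empty set.\<close>

lemma Int_stable_cyls: "Int_stable cyls"
proof -
  have *: "cyl m s \<inter> cyl n t \<in> cyls" if "m \<le> n" "s \<in> seqs" "t \<in> seqs" for m n s t
  proof (cases "cyl m s \<inter> cyl n t = {}")
    case False
    then obtain u where u: "u \<in> seqs" "agree m s u" "agree n t u" by (auto simp: cyl_def)
    have "agree m u t"
      using agree_mono[OF agree_sym[OF u(3)] that(1)] .
    hence "cyl m s = cyl m t"
      using cyl_cong[OF u(2)] cyl_cong by simp
    moreover have "cyl n t \<subseteq> cyl m t"
      using that(1) by (auto simp: cyl_def intro: agree_mono)
    ultimately have "cyl m s \<inter> cyl n t = cyl n t" by blast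
    thus ?thesis using that by (auto simp: cyls_def)
  qed (simp add: cyls_def)
  have "cyl m s \<inter> cyl n t \<in> cyls" if "s \<in> seqs" "t \<in> seqs" for m n s t
    using *[of m n s t] *[of n m t s] that by (cases "m \<le> n") (auto simp: Int_commute)
  note cyl_Int = this
  show ?thesis
    unfolding Int_stable_def
  proof (intro ballI)
    fix X Y assume "X \<in> cyls" "Y \<in> cyls"
    then consider "X \<inter> Y = {}" | m n s t where "s \<in> seqs" "t \<in> seqs" "X = cyl m s" "Y = cyl n t"
      unfolding cyls_def by blast
    thus "X \<inter> Y \<in> cyls"
      using cyl_Int by cases (simp_all add: cyls_def)
  qed
qed

text \<open>Only finitely many prefixes of length \<open>n\<close> exist, and the sequences with a
  given prefix form a cylinder.\<close>

lemma level_set_sigma: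
  assumes "level_set n A"
  shows "A \<in> sigma_sets seqs cyls"
proof -
  have "A = (\<Union>u\<in>trunc n ` A. {t \<in> seqs. trunc n t = u})"
    using assms by (auto simp: level_set_def trunc_eq_iff intro: agree_sym)
  moreover have "(\<Union>u\<in>trunc n ` A. {t \<in> seqs. trunc n t = u}) \<in> sets (sigma seqs cyls)"
  proof (rule sets.finite_UN)
    show "finite (trunc n ` A)"
      by (rule finite_subset[OF _ finite_trunc[of n]]) (use assms in \<open>auto simp: level_set_def\<close>)
    fix u assume "u \<in> trunc n ` A"
    then obtain s where "s \<in> seqs" "u = trunc n s" using assms by (auto simp: level_set_def)
    hence "{t \<in> seqs. trunc n t = u} = cyl n s"
      by (auto simp: cyl_def trunc_eq_iff intro: agree_sym)
    hence "{t \<in> seqs. trunc n t = u} \<in> cyls"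
      using \<open>s \<in> seqs\<close> by (auto simp: cyls_def)
    thus "{t \<in> seqs. trunc n t = u} \<in> sets (sigma seqs cyls)"
      using cyls_subset by simp
  qed
  ultimately show ?thesis
    using cyls_subset by simp
qed

text \<open>These sets increase with \<open>n\<close> and exhaust an open \<open>U\<close>. They
  make open sets countable unions of compact open sets, which serves both measurability and inner
  regularity.\<close>

definition inner :: "nat \<Rightarrow> (nat \<Rightarrow> int) set \<Rightarrow> (nat \<Rightarrow> int) set" where
  "inner n U = {s \<in> seqs. cyl n s \<subseteq> U}"

lemma level_set_inner: "level_set n (inner n U)"
  unfolding level_set_def inner_def using cyl_cong by auto

lemma incseq_inner: "incseq (\<lambda>n. inner n U)"
  unfolding incseq_def inner_def cyl_def using agree_mono by blast

lemma inner_subset: "inner n U \<subseteq> U"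
  by (auto simp: inner_def cyl_def)

lemma open_eq_Union_inner:
  assumes "openin ctop U"
  shows "U = (\<Union>n. inner n U)"
proof
  show "U \<subseteq> (\<Union>n. inner n U)"
  proof
    fix s assume s: "s \<in> U"
    then obtain n where "\<And>t. t \<in> seqs \<Longrightarrow> agree n s t \<Longrightarrow> t \<in> U"
      using openin_ctopE[OF assms] by blast
    hence "s \<in> inner n U"
      using s assms by (auto simp: inner_def cyl_def openin_ctop)
    thus "s \<in> (\<Union>n. inner n U)" by blast
  qed
qed (use inner_subset in blast)

lemma open_sigma:
  assumes "openin ctop U"
  shows "U \<in> sigma_sets seqs cyls"
proof -
  have "(\<Union>n. inner n U) \<in> sigma_sets seqs cyls"
    by (intro sigma_sets.Union level_set_sigma[OF level_set_inner])
  thus ?thesis using open_eq_Union_inner[OF assms] by simp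
qed

lemma sigma_cyls_eq: "sigma_sets seqs cyls = sigma_sets seqs {U. openin ctop U}"
  by (intro antisym sigma_sets_mono subsetI)
     (auto intro: openin_cyls open_sigma)

section \<open>The product measure: invariance and regularity\<close>

lemma space_cmeas: "space cmeas = seqs"
  by (auto simp: cmeas_def space_PiM seqs_def space_uniform_count_measure)

lemma cyl_eq_prod_emb:
  assumes "s \<in> seqs"
  shows "cyl n s = prod_emb UNIV (\<lambda>i. uniform_count_measure (B i)) {..<n} (Pi\<^sub>E {..<n} (\<lambda>i. {s i}))"
  by (auto simp: cyl_def agree_def prod_emb_def seqs_def space_uniform_count_measure PiE_iff)

lemma sets_cmeas: "sets cmeas = sigma_sets seqs cyls"
proof
  have "sets cmeas = sigma_sets seqs {{f\<in>seqs. f i \<in> A} | i A. A \<subseteq> B i}"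
  proof -
    have "(\<Pi>\<^sub>E i\<in>UNIV. space (uniform_count_measure (B i))) = seqs"
      by (auto simp: seqs_def space_uniform_count_measure)
    thus ?thesis
      by (simp add: cmeas_def sets_PiM_single sets_uniform_count_measure)
  qed
  also have "\<dots> \<subseteq> sigma_sets seqs cyls"
  proof (intro sigma_sets_mono subsetI)
    fix X assume "X \<in> {{f\<in>seqs. f i \<in> A} | i A. A \<subseteq> B i}"
    then obtain i A where "X = {f\<in>seqs. f i \<in> A}" by blast
    hence "level_set (Suc i) X" by (auto simp: level_set_def agree_def)
    thus "X \<in> sigma_sets seqs cyls" by (rule level_set_sigma)
  qed
  finally show "sets cmeas \<subseteq> sigma_sets seqs cyls" .
  have "cyl n s \<in> sets cmeas" if "s \<in> seqs" for n s
    unfolding cyl_eq_prod_emb[OF that] cmeas_def using that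
    by (intro sets_PiM_I) (auto simp: sets_uniform_count_measure seqs_def)
  thus "sigma_sets seqs cyls \<subseteq> sets cmeas"
    using sets.sigma_sets_subset[of cyls cmeas] by (auto simp: cyls_def space_cmeas)
qed

lemma product_prob_space_B: "product_prob_space (\<lambda>i. uniform_count_measure (B i))"
  by (intro product_prob_spaceI prob_space_uniform_count_measure finite_B B_nonempty)

lemma prob_space_cmeas: "prob_space cmeas"
  unfolding cmeas_def by (intro prob_space_PiM prob_space_uniform_count_measure finite_B B_nonempty)

text \<open>For invariance it matters only that the value is independent of
  \<open>s\<close>.\<close>

lemma emeasure_cyl:
  assumes "s \<in> seqs"
  shows "emeasure cmeas (cyl n s) = (\<Prod>i<n. ennreal (1 / real (card (B i))))"
proof -
  interpret product_prob_space "\<lambda>i. uniform_count_measure (B i)" UNIV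
    by (rule product_prob_space_B)
  have "emeasure cmeas (cyl n s) = (\<Prod>i<n. emeasure (uniform_count_measure (B i)) {s i})"
    unfolding cyl_eq_prod_emb[OF assms] cmeas_def
    using assms by (intro emeasure_PiM_emb) (auto simp: sets_uniform_count_measure seqs_def)
  also have "\<dots> = (\<Prod>i<n. ennreal (1 / real (card (B i))))"
    using assms by (intro prod.cong refl) (simp add: emeasure_uniform_count_measure finite_B seqs_def)
  finally show ?thesis .
qed

lemma cyl_vimage:
  assumes "g \<in> seqs" "s \<in> seqs"
  shows "{h \<in> seqs. inv\<^bsub>cgroup\<^esub> g \<otimes>\<^bsub>cgroup\<^esub> h \<in> cyl n s} = cyl n (g \<otimes>\<^bsub>cgroup\<^esub> s)"
proof -
  have "agree n s (inv\<^bsub>cgroup\<^esub> g \<otimes>\<^bsub>cgroup\<^esub> h) \<longleftrightarrow> agree n (g \<otimes>\<^bsub>cgroup\<^esub> s) h" if h: "h \<in> seqs" for h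
  proof
    assume "agree n s (inv\<^bsub>cgroup\<^esub> g \<otimes>\<^bsub>cgroup\<^esub> h)"
    hence "agree n (g \<otimes>\<^bsub>cgroup\<^esub> s) (g \<otimes>\<^bsub>cgroup\<^esub> (inv\<^bsub>cgroup\<^esub> g \<otimes>\<^bsub>cgroup\<^esub> h))"
      using assms h by (intro agree_mult_cong) (auto simp: mult_in)
    thus "agree n (g \<otimes>\<^bsub>cgroup\<^esub> s) h"
      using assms h by (simp add: C.m_assoc[symmetric])
  next
    assume "agree n (g \<otimes>\<^bsub>cgroup\<^esub> s) h"
    hence "agree n (inv\<^bsub>cgroup\<^esub> g \<otimes>\<^bsub>cgroup\<^esub> (g \<otimes>\<^bsub>cgroup\<^esub> s)) (inv\<^bsub>cgroup\<^esub> g \<otimes>\<^bsub>cgroup\<^esub> h)"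
      using assms h by (intro agree_mult_cong) (auto simp: mult_in)
    thus "agree n s (inv\<^bsub>cgroup\<^esub> g \<otimes>\<^bsub>cgroup\<^esub> h)"
      using assms h by (simp add: C.m_assoc[symmetric])
  qed
  thus ?thesis
    using assms by (auto simp: cyl_def mult_in)
qed

text \<open>Translation takes a cylinder to a cylinder of the same length, hence of the same
  measure, and the cylinders form an intersection-stable generator.\<close>

lemma cmeas_left_invariant:
  assumes g: "g \<in> seqs" and A: "A \<in> sets cmeas"
  shows "emeasure cmeas ((\<lambda>h. g \<otimes>\<^bsub>cgroup\<^esub> h) ` A) = emeasure cmeas A"
proof -
  \<comment> \<open>Images under translation by \<open>g\<close> are preimages under translation by
    its inverse, so the claim becomes one about \<open>distr\<close>.\<close>
  let ?f = "\<lambda>h. inv\<^bsub>cgroup\<^esub> g \<otimes>\<^bsub>cgroup\<^esub> h"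
  have vim: "?f -` X \<inter> seqs \<in> cyls" if X: "X \<in> cyls" for X
  proof (cases "X = {}")
    case True
    thus ?thesis by (simp add: cyls_def)
  next
    case False
    then obtain n s where s: "s \<in> seqs" "X = cyl n s" using X by (auto simp: cyls_def)
    have "?f -` X \<inter> seqs = cyl n (g \<otimes>\<^bsub>cgroup\<^esub> s)"
      unfolding cyl_vimage[OF g s(1), symmetric] s(2) by auto
    thus ?thesis using mult_in[OF g s(1)] by (auto simp: cyls_def)
  qed
  have meas: "?f \<in> measurable cmeas cmeas"
  proof (rule measurable_sigma_sets[OF sets_cmeas cyls_subset])
    show "?f \<in> space cmeas \<rightarrow> seqs"
      using g by (auto simp: space_cmeas mult_in)
    show "?f -` X \<inter> space cmeas \<in> sets cmeas" if "X \<in> cyls" for X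
      using vim[OF that] by (auto simp: sets_cmeas space_cmeas)
  qed
  have "distr cmeas cmeas ?f = cmeas"
  proof (rule measure_eqI_generator_eq[OF Int_stable_cyls cyls_subset])
    fix X assume X: "X \<in> cyls"
    show "emeasure (distr cmeas cmeas ?f) X = emeasure cmeas X"
    proof (cases "X = {}")
      case False
      then obtain n s where s: "s \<in> seqs" "X = cyl n s" using X by (auto simp: cyls_def)
      have "X \<in> sets cmeas" using X by (auto simp: sets_cmeas)
      hence "emeasure (distr cmeas cmeas ?f) X = emeasure cmeas (?f -` X \<inter> seqs)"
        using emeasure_distr[OF meas] by (simp add: space_cmeas)
      also have "?f -` X \<inter> seqs = cyl n (g \<otimes>\<^bsub>cgroup\<^esub> s)"
        unfolding cyl_vimage[OF g s(1), symmetric] s(2) by auto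
      finally show ?thesis
        using s mult_in[OF g s(1)] by (simp add: emeasure_cyl)
    qed simp
  next
    \<comment> \<open>The whole space is a cylinder of length zero, so a constant exhausting
      sequence will do.\<close>
    show "range (\<lambda>i::nat. seqs) \<subseteq> cyls"
      using digits_in[OF one_closed] by (auto simp: cyls_def cyl_def intro!: exI[of _ 0])
    show "emeasure (distr cmeas cmeas ?f) seqs \<noteq> \<infinity>"
      using prob_space.prob_space_distr[OF prob_space_cmeas meas]
      by (metis prob_space.emeasure_le_1 ennreal_one_less_top infinity_ennreal_def leD)
  qed (auto simp: sets_cmeas)
  moreover have "(\<lambda>h. g \<otimes>\<^bsub>cgroup\<^esub> h) ` A = ?f -` A \<inter> space cmeas"
  proof -
    have sub: "A \<subseteq> seqs" using sets.sets_into_space[OF A] by (simp add: space_cmeas)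
    show ?thesis
    proof (intro equalityI subsetI)
      fix t assume "t \<in> (\<lambda>h. g \<otimes>\<^bsub>cgroup\<^esub> h) ` A"
      then obtain h where "h \<in> A" "t = g \<otimes>\<^bsub>cgroup\<^esub> h" by blast
      moreover from this sub have "h \<in> seqs" by blast
      ultimately show "t \<in> ?f -` A \<inter> space cmeas"
        using g by (simp add: space_cmeas mult_in C.m_assoc[symmetric])
    next
      fix t assume "t \<in> ?f -` A \<inter> space cmeas"
      hence t: "?f t \<in> A" "t \<in> seqs" by (auto simp: space_cmeas)
      moreover have "t = g \<otimes>\<^bsub>cgroup\<^esub> ?f t"
        using g t by (simp add: C.m_assoc[symmetric])
      ultimately show "t \<in> (\<lambda>h. g \<otimes>\<^bsub>cgroup\<^esub> h) ` A" by blast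
    qed
  qed
  ultimately show ?thesis
    using emeasure_distr[OF meas A] by simp
qed

text \<open>Outer regularity of \<open>A\<close> and of its complement in one symmetric statement.
  In this form complementation merely swaps \<open>U\<close> and \<open>V\<close>, which lets the
  induction over the sigma-algebra go through.\<close>

lemma sandwich:
  assumes "A \<in> sets cmeas" "e > 0"
  shows "\<exists>U V. openin ctop U \<and> openin ctop V \<and> A \<subseteq> U \<and> seqs - A \<subseteq> V \<and> measure cmeas (U \<inter> V) < e"
  using assms unfolding sets_cmeas
proof (induction arbitrary: e rule: sigma_sets.induct)
  case (Basic A)
  thus ?case using openin_cyls[of A] closedin_cyls[of A]
    by (intro exI[of _ A] exI[of _ "seqs - A"]) (auto simp: closedin_def topspace_ctop)
next
  case Empty
  thus ?case using openin_topspace[of ctop]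
    by (intro exI[of _ "{}"] exI[of _ seqs]) (auto simp: topspace_ctop)
next
  case (Compl A)
  have "A \<subseteq> seqs"
    using Compl.hyps sets.sets_into_space[of A cmeas] by (simp add: sets_cmeas space_cmeas)
  moreover obtain U V where "openin ctop U" "openin ctop V" "A \<subseteq> U" "seqs - A \<subseteq> V" "measure cmeas (U \<inter> V) < e"
    using Compl.IH[OF Compl.prems] by blast
  ultimately show ?case
    by (intro exI[of _ V] exI[of _ U]) (auto simp: Int_commute)
next
  case (Union A)
  interpret prob_space cmeas by (rule prob_space_cmeas)
  have om: "X \<in> sets cmeas" if "openin ctop X" for X
    using open_sigma[OF that] by (simp add: sets_cmeas)
  \<comment> \<open>These tolerances add up to at most \<open>e / 2\<close>; the other half pays for
    cutting off the infinite union.\<close>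
  have "\<forall>i. \<exists>U V. openin ctop U \<and> openin ctop V \<and> A i \<subseteq> U \<and> seqs - A i \<subseteq> V \<and>
      measure cmeas (U \<inter> V) < (e / 4) * (1/2) ^ i"
    by (intro allI Union.IH) (use Union.prems in simp)
  then obtain U V where UV: "\<And>i. openin ctop (U i)" "\<And>i. openin ctop (V i)" "\<And>i. A i \<subseteq> U i"
      "\<And>i. seqs - A i \<subseteq> V i" "\<And>i. measure cmeas (U i \<inter> V i) < (e / 4) * (1/2) ^ i"
    by metis
  have UVm: "U i \<in> sets cmeas" "V i \<in> sets cmeas" for i
    using UV om by auto
  have "(\<lambda>n. measure cmeas (\<Union>i\<le>n. U i)) \<longlonglongrightarrow> measure cmeas (\<Union>n. \<Union>i\<le>n. U i)"
    using UVm by (intro finite_Lim_measure_incseq) (auto simp: incseq_def, force)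
  moreover have "(\<Union>n. \<Union>i\<le>n. U i) = (\<Union>i. U i)" by auto
  ultimately have "(\<lambda>n. measure cmeas (\<Union>i\<le>n. U i)) \<longlonglongrightarrow> measure cmeas (\<Union>i. U i)" by simp
  hence "\<forall>\<^sub>F n in sequentially. measure cmeas (\<Union>i\<le>n. U i) > measure cmeas (\<Union>i. U i) - e / 2"
    using Union.prems by (intro order_tendstoD(1)) auto
  then obtain n where n: "measure cmeas (\<Union>i\<le>n. U i) > measure cmeas (\<Union>i. U i) - e / 2"
    by (auto simp: eventually_sequentially)
  \<comment> \<open>Only a finite intersection of the \<open>V i\<close> is sure to be open. By the
    choice of \<open>n\<close>, the sets \<open>U i\<close> with larger index add less than
    \<open>e / 2\<close> to the union.\<close>
  define W where "W = (\<Inter>i\<le>n. V i)"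
  have W: "openin ctop W"
    unfolding W_def using UV(2) by (intro openin_INT2) auto
  have U: "openin ctop (\<Union>i. U i)"
    using UV(1) by auto
  have "measure cmeas ((\<Union>i. U i) \<inter> W) \<le>
      measure cmeas ((\<Union>i\<le>n. U i \<inter> V i) \<union> ((\<Union>i. U i) - (\<Union>i\<le>n. U i)))"
    using UVm by (intro finite_measure_mono sets.Un sets.Diff sets.finite_UN sets.Int sets.countable_UN)
      (auto simp: W_def)
  also have "\<dots> \<le> measure cmeas (\<Union>i\<le>n. U i \<inter> V i) + measure cmeas ((\<Union>i. U i) - (\<Union>i\<le>n. U i))"
    using UVm by (intro measure_Un_le sets.Diff sets.finite_UN sets.Int sets.countable_UN) auto
  also have "measure cmeas ((\<Union>i. U i) - (\<Union>i\<le>n. U i)) = measure cmeas (\<Union>i. U i) - measure cmeas (\<Union>i\<le>n. U i)"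
    using UVm by (intro finite_measure_Diff sets.finite_UN sets.countable_UN) auto
  also have "\<dots> < e / 2" using n by simp
  also have "measure cmeas (\<Union>i\<le>n. U i \<inter> V i) \<le> (\<Sum>i\<le>n. measure cmeas (U i \<inter> V i))"
    using UVm by (intro finite_measure_subadditive_finite) auto
  also have "\<dots> \<le> (\<Sum>i\<le>n. (e / 4) * (1/2) ^ i)"
    using UV(5) by (intro sum_mono less_imp_le) 
  also have "\<dots> = (e / 4) * (\<Sum>i\<le>n. (1/2) ^ i)"
    by (simp add: sum_distrib_left)
  also have "(\<Sum>i\<le>n. (1/2::real) ^ i) = 2 - (1/2) ^ n"
    by (induction n) (auto simp: field_simps)
  also have "(e / 4) * (2 - (1/2) ^ n) \<le> e / 2"
    using Union.prems by (simp add: field_simps)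
  finally have "measure cmeas ((\<Union>i. U i) \<inter> W) < e" by simp
  moreover have "seqs - (\<Union>i. A i) \<subseteq> W" using UV(4) by (auto simp: W_def)
  moreover have "(\<Union>i. A i) \<subseteq> (\<Union>i. U i)" using UV(3) by blast
  ultimately show ?case using U W
    by (intro exI[of _ "\<Union>i. U i"] exI[of _ W] conjI)
qed

lemma open_sets_cmeas: "openin ctop U \<Longrightarrow> U \<in> sets cmeas"
  using open_sigma by (simp add: sets_cmeas)

text \<open>For \<open>U\<close> and \<open>V\<close> from \<open>sandwich\<close>, the excess of
  \<open>U\<close> over \<open>A\<close> lies in \<open>U \<inter> V\<close>.\<close>

lemma outer_regular_cmeas:
  assumes A: "A \<in> sets cmeas"
  shows "emeasure cmeas A = (INF U\<in>{U. openin ctop U \<and> A \<subseteq> U}. emeasure cmeas U)" (is "_ = ?I")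
proof (rule antisym)
  interpret prob_space cmeas by (rule prob_space_cmeas)
  show "emeasure cmeas A \<le> ?I"
  proof (rule INF_greatest)
    fix U assume "U \<in> {U. openin ctop U \<and> A \<subseteq> U}"
    thus "emeasure cmeas A \<le> emeasure cmeas U"
      by (intro emeasure_mono open_sets_cmeas) simp_all
  qed
  show "?I \<le> emeasure cmeas A"
  proof (rule ennreal_le_epsilon)
    fix e :: real assume "e > 0"
    obtain U V where UV: "openin ctop U" "openin ctop V" "A \<subseteq> U" "seqs - A \<subseteq> V" "measure cmeas (U \<inter> V) < e"
      using sandwich[OF A \<open>e > 0\<close>] by blast
    have UVm: "U \<in> sets cmeas" "V \<in> sets cmeas"
      by (intro open_sets_cmeas UV)+
    have "U \<subseteq> seqs"
      using openin_subset[OF UV(1)] by (simp add: topspace_ctop)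
    hence "U \<subseteq> A \<union> (U \<inter> V)"
      using UV(4) by blast
    have "?I \<le> emeasure cmeas U"
      using UV by (intro INF_lower) simp
    also have "\<dots> \<le> emeasure cmeas (A \<union> (U \<inter> V))"
      using A UVm \<open>U \<subseteq> A \<union> (U \<inter> V)\<close> by (intro emeasure_mono sets.Un sets.Int)
    also have "\<dots> \<le> emeasure cmeas A + emeasure cmeas (U \<inter> V)"
      using A UVm by (intro emeasure_subadditive sets.Int)
    also have "\<dots> \<le> emeasure cmeas A + ennreal e"
      unfolding emeasure_eq_measure[of "U \<inter> V"] using UV(5) by (intro add_left_mono ennreal_leI) simp
    finally show "?I \<le> emeasure cmeas A + ennreal e" .
  qed
qed

text \<open>The compact sets \<open>inner n U\<close> exhaust \<open>U\<close>, so continuity from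
  below suffices.\<close>

lemma inner_regular_cmeas:
  assumes U: "openin ctop U"
  shows "emeasure cmeas U = (SUP K\<in>{K. compactin ctop K \<and> K \<in> sets cmeas \<and> K \<subseteq> U}. emeasure cmeas K)"
    (is "_ = ?S")
proof (rule antisym)
  have im: "inner n U \<in> sets cmeas" for n
    using level_set_sigma[OF level_set_inner] by (simp add: sets_cmeas)
  have "emeasure cmeas U = emeasure cmeas (\<Union>n. inner n U)"
    by (rule arg_cong[OF open_eq_Union_inner[OF U]])
  also have "\<dots> = (SUP n. emeasure cmeas (inner n U))"
    using im by (intro SUP_emeasure_incseq[symmetric] incseq_inner) auto
  also have "\<dots> \<le> ?S"
    using im level_set_compactin[OF level_set_inner] inner_subset
    by (intro SUP_least SUP_upper) simp
  finally show "emeasure cmeas U \<le> ?S" .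
  show "?S \<le> emeasure cmeas U"
  proof (rule SUP_least)
    fix K assume "K \<in> {K. compactin ctop K \<and> K \<in> sets cmeas \<and> K \<subseteq> U}"
    thus "emeasure cmeas K \<le> emeasure cmeas U"
      by (intro emeasure_mono open_sets_cmeas U) simp
  qed
qed

lemma haar_cmeas: "normalised_haar_measure cgroup ctop cmeas"
  unfolding normalised_haar_measure_def space_cmeas topspace_ctop carrier_cgroup
  by (intro conjI ballI allI impI refl prob_space_cmeas cmeas_left_invariant outer_regular_cmeas
      inner_regular_cmeas sets_cmeas[unfolded sigma_cyls_eq])

section \<open>Openizers tested at finite levels\<close>

lemma closed_generate_iff:
  "s \<in> closed_generate cgroup ctop X \<longleftrightarrow> s \<in> seqs \<and> (\<forall>n. \<exists>h\<in>generate cgroup X \<inter> seqs. agree n s h)"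
proof
  assume s: "s \<in> closed_generate cgroup ctop X"
  show "s \<in> seqs \<and> (\<forall>n. \<exists>h\<in>generate cgroup X \<inter> seqs. agree n s h)"
  proof (intro conjI allI)
    show "s \<in> seqs" using s by (auto simp: closed_generate_def in_closure_of topspace_ctop)
    fix n
    have "openin ctop (cyl n s)" by (rule level_set_openin[OF level_set_cyl])
    moreover have "s \<in> cyl n s" using \<open>s \<in> seqs\<close> by (simp add: cyl_def)
    ultimately obtain h where "h \<in> generate cgroup X" "h \<in> cyl n s"
      using s by (auto simp: closed_generate_def in_closure_of)
    thus "\<exists>h\<in>generate cgroup X \<inter> seqs. agree n s h"
      by (auto simp: cyl_def)
  qed
next
  assume s: "s \<in> seqs \<and> (\<forall>n. \<exists>h\<in>generate cgroup X \<inter> seqs. agree n s h)"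
  show "s \<in> closed_generate cgroup ctop X"
    unfolding closed_generate_def in_closure_of topspace_ctop
  proof (intro conjI allI impI)
    show "s \<in> seqs" using s by blast
    fix T assume T: "s \<in> T \<and> openin ctop T"
    obtain n where n: "\<And>t. t \<in> seqs \<Longrightarrow> agree n s t \<Longrightarrow> t \<in> T"
      using openin_ctopE T by blast
    obtain h where "h \<in> generate cgroup X \<inter> seqs" "agree n s h" using s by blast
    thus "\<exists>h. h \<in> generate cgroup X \<and> h \<in> T" using n by blast
  qed
qed

text \<open>A group word evaluated at \<open>x\<close>, \<open>y\<close> and at the representatives
  \<open>a\<close>, \<open>b\<close> gives results that agree to \<open>n\<close> digits.\<close>

lemma
  assumes "x \<in> seqs" "y \<in> seqs" "a \<in> carrier \<Gamma>" "b \<in> carrier \<Gamma>"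
    and ag: "agree n (digits a) x" "agree n (digits b) y"
  shows generate_levelD: "h \<in> generate cgroup {x, y} \<Longrightarrow> \<exists>\<eta>\<in>generate \<Gamma> {a, b}. agree n (digits \<eta>) h"
    and generate_levelU: "\<eta> \<in> generate \<Gamma> {a, b} \<Longrightarrow> \<exists>h\<in>generate cgroup {x, y}. agree n (digits \<eta>) h"
proof -
  have gc: "generate \<Gamma> {a, b} \<subseteq> carrier \<Gamma>"
    using assms by (intro generate_incl) auto
  have gs: "generate cgroup {x, y} \<subseteq> seqs"
    using C.generate_incl[of "{x, y}"] assms by auto
  have inv: "agree n (digits (inv a)) (inv\<^bsub>cgroup\<^esub> x)" "agree n (digits (inv b)) (inv\<^bsub>cgroup\<^esub> y)"
    using assms by (intro agree_sym[OF agree_inv]; simp)+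
  have mult: "agree n (digits (c \<otimes> d)) (s \<otimes>\<^bsub>cgroup\<^esub> t)"
    if "c \<in> generate \<Gamma> {a, b}" "d \<in> generate \<Gamma> {a, b}" "s \<in> generate cgroup {x, y}" "t \<in> generate cgroup {x, y}"
      "agree n (digits c) s" "agree n (digits d) t" for c d s t
    by (rule agree_sym, rule agree_mult) (use that gc gs in blast)+
  show "\<exists>\<eta>\<in>generate \<Gamma> {a, b}. agree n (digits \<eta>) h" if "h \<in> generate cgroup {x, y}"
    using that
  proof (induction rule: generate.induct)
    case one
    show ?case unfolding one_cgroup by (rule bexI[OF _ generate.one]) (rule agree_refl)
  next
    case (incl h)
    hence "h = x \<or> h = y" by simp
    thus ?case using ag generate.incl[of a "{a, b}" \<Gamma>] generate.incl[of b "{a, b}" \<Gamma>] by auto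
  next
    case (inv h)
    hence "h = x \<or> h = y" by simp
    thus ?case using \<open>agree n (digits (inv a)) _\<close> \<open>agree n (digits (inv b)) _\<close>
      generate.inv[of a "{a, b}" \<Gamma>] generate.inv[of b "{a, b}" \<Gamma>] by auto
  next
    case (eng s t)
    then obtain c d where "c \<in> generate \<Gamma> {a, b}" "d \<in> generate \<Gamma> {a, b}" "agree n (digits c) s" "agree n (digits d) t"
      by blast
    thus ?case using mult eng.hyps generate.eng by (intro bexI[of _ "c \<otimes> d"])
  qed
  show "\<exists>h\<in>generate cgroup {x, y}. agree n (digits \<eta>) h" if "\<eta> \<in> generate \<Gamma> {a, b}"
    using that
  proof (induction rule: generate.induct)
    case one
    show ?case unfolding one_cgroup[symmetric] by (rule bexI[OF _ generate.one]) (rule agree_refl)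
  next
    case (incl h)
    hence "h = a \<or> h = b" by simp
    thus ?case using ag generate.incl[of x "{x, y}" cgroup] generate.incl[of y "{x, y}" cgroup] by auto
  next
    case (inv h)
    hence "h = a \<or> h = b" by simp
    thus ?case using \<open>agree n (digits (inv a)) _\<close> \<open>agree n (digits (inv b)) _\<close>
      generate.inv[of x "{x, y}" cgroup] generate.inv[of y "{x, y}" cgroup] by auto
  next
    case (eng c d)
    then obtain s t where "s \<in> generate cgroup {x, y}" "t \<in> generate cgroup {x, y}" "agree n (digits c) s" "agree n (digits d) t"
      by blast
    thus ?case using mult eng.hyps generate.eng by (intro bexI[of _ "s \<otimes>\<^bsub>cgroup\<^esub> t"])
  qed
qed

text \<open>A closed subgroup is open iff, for some \<open>m\<close>, it contains everything
  agreeing with the identity to \<open>m\<close> digits. Membership in a closure is tested at each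
  level \<open>n\<close>, where \<open>y\<close> may be replaced by a representative; this moves the
  question into \<open>\<Gamma>\<close>.\<close>

lemma openizer_iff:
  assumes \<xi>: "\<xi> \<in> carrier \<Gamma>"
  shows "y \<in> openizer cgroup ctop (digits \<xi>) \<longleftrightarrow> y \<in> seqs \<and>
    (\<exists>m. \<forall>n. \<forall>\<gamma>\<in>carrier \<Gamma>. agree n (digits \<gamma>) y \<longrightarrow>
      (\<forall>\<sigma>\<in>carrier \<Gamma>. agree m (digits \<sigma>) (digits \<one>) \<longrightarrow>
        (\<exists>\<eta>\<in>generate \<Gamma> {\<xi>, \<gamma>}. agree n (digits \<eta>) (digits \<sigma>))))"
    (is "_ \<longleftrightarrow> _ \<and> ?R")
proof (cases "y \<in> seqs")
  case False
  thus ?thesis by (simp add: openizer_def)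
next
  case y: True
  let ?H = "closed_generate cgroup ctop {digits \<xi>, y}"
  have x: "digits \<xi> \<in> seqs" using \<xi> by (rule digits_in)
  have gs: "generate cgroup {digits \<xi>, y} \<subseteq> seqs"
    using C.generate_incl[of "{digits \<xi>, y}"] x y by auto
  have H: "s \<in> ?H \<longleftrightarrow> s \<in> seqs \<and> (\<forall>n. \<exists>h\<in>generate cgroup {digits \<xi>, y}. agree n s h)" for s
    using closed_generate_iff[of s "{digits \<xi>, y}"] gs by (simp add: Int_absorb2)
  have "openin ctop ?H \<longleftrightarrow> ?R"
  proof
    assume o: "openin ctop ?H"
    have "\<one>\<^bsub>cgroup\<^esub> \<in> ?H"
      unfolding H using generate.one[of cgroup "{digits \<xi>, y}"] C.one_closed agree_refl by blast
    then obtain m where m: "\<And>t. t \<in> seqs \<Longrightarrow> agree m \<one>\<^bsub>cgroup\<^esub> t \<Longrightarrow> t \<in> ?H"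
      using openin_ctopE[OF o] by blast
    show ?R
    proof (intro exI[of _ m] allI ballI impI)
      fix n \<gamma> \<sigma> assume \<gamma>: "\<gamma> \<in> carrier \<Gamma>" "agree n (digits \<gamma>) y"
        and \<sigma>: "\<sigma> \<in> carrier \<Gamma>" "agree m (digits \<sigma>) (digits \<one>)"
      have "digits \<sigma> \<in> ?H"
        using m[OF digits_in[OF \<sigma>(1)]] agree_sym[OF \<sigma>(2)] by (simp add: one_cgroup)
      then obtain h where h: "h \<in> generate cgroup {digits \<xi>, y}" "agree n (digits \<sigma>) h"
        unfolding H by blast
      obtain \<eta> where "\<eta> \<in> generate \<Gamma> {\<xi>, \<gamma>}" "agree n (digits \<eta>) h"
        using generate_levelD[OF x y \<xi> \<gamma>(1) agree_refl \<gamma>(2) h(1)] by blast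
      thus "\<exists>\<eta>\<in>generate \<Gamma> {\<xi>, \<gamma>}. agree n (digits \<eta>) (digits \<sigma>)"
        using agree_trans[OF _ agree_sym[OF h(2)]] by blast
    qed
  next
    assume ?R
    then obtain m where m: "\<And>n \<gamma> \<sigma>. \<gamma> \<in> carrier \<Gamma> \<Longrightarrow> agree n (digits \<gamma>) y \<Longrightarrow> \<sigma> \<in> carrier \<Gamma> \<Longrightarrow>
        agree m (digits \<sigma>) (digits \<one>) \<Longrightarrow> \<exists>\<eta>\<in>generate \<Gamma> {\<xi>, \<gamma>}. agree n (digits \<eta>) (digits \<sigma>)"
      by blast
    have K: "\<exists>h\<in>generate cgroup {digits \<xi>, y}. agree n u h"
      if u: "u \<in> seqs" "agree m \<one>\<^bsub>cgroup\<^esub> u" for u n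
    proof -
      \<comment> \<open>The level must be at least \<open>m\<close> for the representative of
        \<open>u\<close> to inherit agreement with the identity, and at least \<open>n\<close> for
        the conclusion.\<close>
      define n' where "n' = max m n"
      have le: "m \<le> n'" "n \<le> n'" by (auto simp: n'_def)
      note \<gamma> = rep[OF y, of n'] and \<sigma> = rep[OF u(1), of n']
      have "agree m (digits (rep n' u)) (digits \<one>)"
        using agree_trans[OF agree_mono[OF \<sigma>(2) le(1)] agree_sym[OF u(2)]] by (simp add: one_cgroup)
      then obtain \<eta> where \<eta>: "\<eta> \<in> generate \<Gamma> {\<xi>, rep n' y}" "agree n' (digits \<eta>) (digits (rep n' u))"
        using m[OF \<gamma> \<sigma>(1)] by blast
      obtain h where h: "h \<in> generate cgroup {digits \<xi>, y}" "agree n' (digits \<eta>) h"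
        using generate_levelU[OF x y \<xi> \<gamma>(1) agree_refl \<gamma>(2) \<eta>(1)] by blast
      have "agree n' u h"
        using agree_trans[OF agree_trans[OF agree_sym[OF \<sigma>(2)] agree_sym[OF \<eta>(2)]] h(2)] .
      thus ?thesis using h(1) agree_mono[OF _ le(2)] by blast
    qed
    show "openin ctop ?H"
      unfolding openin_ctop
    proof (intro conjI ballI)
      show "?H \<subseteq> seqs" using H by blast
      fix s assume "s \<in> ?H"
      have "t \<in> ?H" if t: "t \<in> seqs" "agree m s t" for t
        unfolding H
      proof (intro conjI allI)
        fix n
        \<comment> \<open>Dividing \<open>t\<close> by an approximation \<open>h\<close> of
          \<open>s\<close> gives an element that agrees with the identity to \<open>m\<close>
          digits, to which \<open>K\<close> applies.\<close>
        obtain h where h: "h \<in> generate cgroup {digits \<xi>, y}" "agree m s h"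
          using \<open>s \<in> ?H\<close> unfolding H by blast
        have hs: "h \<in> seqs" using h gs by blast
        have "agree m (inv\<^bsub>cgroup\<^esub> h \<otimes>\<^bsub>cgroup\<^esub> h) (inv\<^bsub>cgroup\<^esub> h \<otimes>\<^bsub>cgroup\<^esub> t)"
          using hs t agree_trans[OF agree_sym[OF h(2)] t(2)] by (intro agree_mult_cong) auto
        hence "agree m \<one>\<^bsub>cgroup\<^esub> (inv\<^bsub>cgroup\<^esub> h \<otimes>\<^bsub>cgroup\<^esub> t)"
          using hs by simp
        then obtain h' where h': "h' \<in> generate cgroup {digits \<xi>, y}" "agree n (inv\<^bsub>cgroup\<^esub> h \<otimes>\<^bsub>cgroup\<^esub> t) h'"
          using K mult_in hs t by (meson C.inv_closed)
        have "agree n (h \<otimes>\<^bsub>cgroup\<^esub> (inv\<^bsub>cgroup\<^esub> h \<otimes>\<^bsub>cgroup\<^esub> t)) (h \<otimes>\<^bsub>cgroup\<^esub> h')"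
          using hs t h' gs by (intro agree_mult_cong) (auto simp: mult_in)
        hence "agree n t (h \<otimes>\<^bsub>cgroup\<^esub> h')"
          using hs t by (simp add: C.m_assoc[symmetric])
        thus "\<exists>h\<in>generate cgroup {digits \<xi>, y}. agree n t h"
          using generate.eng[OF h(1) h'(1)] by blast
      qed (rule t)
      thus "\<exists>n. \<forall>t\<in>seqs. agree n s t \<longrightarrow> t \<in> ?H" by blast
    qed
  qed
  thus ?thesis using y by (simp add: openizer_def)
qed

lemma measure_box:
  assumes "finite J" "\<And>i. i \<in> J \<Longrightarrow> X i \<subseteq> B i"
  shows "measure cmeas {y \<in> seqs. \<forall>i\<in>J. y i \<in> X i} = (\<Prod>i\<in>J. real (card (X i)) / real (card (B i)))"
proof -
  interpret product_prob_space "\<lambda>i. uniform_count_measure (B i)" UNIV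
    by (rule product_prob_space_B)
  have "{y \<in> seqs. \<forall>i\<in>J. y i \<in> X i} = prod_emb UNIV (\<lambda>i. uniform_count_measure (B i)) J (Pi\<^sub>E J X)"
    by (auto simp: prod_emb_def seqs_def space_uniform_count_measure PiE_iff)
  hence "measure cmeas {y \<in> seqs. \<forall>i\<in>J. y i \<in> X i} = (\<Prod>i\<in>J. measure (uniform_count_measure (B i)) (X i))"
    using assms unfolding cmeas_def by (simp add: measure_PiM_emb sets_uniform_count_measure)
  also have "\<dots> = (\<Prod>i\<in>J. real (card (X i)) / real (card (B i)))"
    using assms by (intro prod.cong refl measure_uniform_count_measure finite_B)
  finally show ?thesis .
qed

end

section \<open>Lattices of functions with shifts\<close>

lemma mod_power_eq_iff_digits:
  fixes a b p :: int
  assumes "p > 0"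
  shows "a mod p ^ L = b mod p ^ L \<longleftrightarrow> (\<forall>l<L. a div p ^ l mod p = b div p ^ l mod p)"
proof (induction L)
  case (Suc L)
  have split: "c mod p ^ Suc L = p ^ L * (c div p ^ L mod p) + c mod p ^ L" for c
    using zmod_zmult2_eq[of p c "p ^ L"] assms by (simp add: mult.commute)
  have "a mod p ^ Suc L = b mod p ^ Suc L \<longleftrightarrow>
      a mod p ^ L = b mod p ^ L \<and> a div p ^ L mod p = b div p ^ L mod p"
  proof
    assume *: "a mod p ^ Suc L = b mod p ^ Suc L"
    have "a mod p ^ L = b mod p ^ L"
      using arg_cong[OF *, of "\<lambda>c. c mod p ^ L"] by (simp add: mod_mod_cancel)
    moreover from this have "p ^ L * (a div p ^ L mod p) = p ^ L * (b div p ^ L mod p)"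
      using * split[of a] split[of b] by linarith
    ultimately show "a mod p ^ L = b mod p ^ L \<and> a div p ^ L mod p = b div p ^ L mod p"
      using assms by simp
  qed (simp only: split)
  also have "\<dots> \<longleftrightarrow> (\<forall>l<Suc L. a div p ^ l mod p = b div p ^ l mod p)"
    unfolding Suc.IH by (auto simp: less_Suc_eq)
  finally show ?case .
qed simp

lemma ex_int_with_digits:
  fixes p :: int
  assumes "p > 0" "\<And>l. c l \<in> {0..<p}"
  shows "\<exists>a. \<forall>l<L. a div p ^ l mod p = c l"
  using assms(2)
proof (induction L arbitrary: c)
  case (Suc L)
  obtain a where a: "\<And>l. l < L \<Longrightarrow> a div p ^ l mod p = c (Suc l)"
    using Suc.IH[of "\<lambda>l. c (Suc l)"] Suc.prems by blast
  have c0: "0 \<le> c 0" "c 0 < p" using Suc.prems[of 0] by auto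
  have "(c 0 + p * a) div p ^ l mod p = c l" if "l < Suc L" for l
  proof (cases l)
    case 0
    thus ?thesis using c0 by simp
  next
    case (Suc j)
    have "(c 0 + p * a) div p ^ l = (c 0 + p * a) div p div p ^ j"
      using assms(1) by (simp add: Suc zdiv_zmult2_eq)
    also have "(c 0 + p * a) div p = a" using c0 by simp
    finally show ?thesis using a[of j] that Suc by simp
  qed
  thus ?case by blast
qed simp

section \<open>The extension of the function lattices by shifts\<close>

locale shift_group =
  fixes p k :: nat
  assumes p: "prime p"
begin

text \<open>The exponent starts at \<open>2\<close> so that the residue class of \<open>1\<close>
  modulo \<open>p\<close> contains points distinct modulo \<open>q i\<close>;
  \<open>not_all_generated\<close> needs two of them. It grows with \<open>i\<close> to make the
  periods of different components different.\<close>

abbreviation q :: "nat \<Rightarrow> int" where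
  "q i \<equiv> int p ^ (i + 2)"

text \<open>A semidirect product in which \<open>t i\<close> translates the \<open>i\<close>-th
  function. Neither the functions of period \<open>q i\<close> nor the shift amounts divisible by
  \<open>p^(k+2)\<close> are factored out here; the digits ignore both.\<close>

definition \<Gamma> :: "((nat \<Rightarrow> int \<Rightarrow> int) \<times> (nat \<Rightarrow> int)) monoid" where
  "\<Gamma> = \<lparr>carrier = {(f, t). \<forall>i x y. int p * q i dvd x - y \<longrightarrow> f i x = f i y},
     monoid.mult = (\<lambda>(f, t) (g, s). (\<lambda>i x. f i x + g i (x - t i), \<lambda>i. t i + s i)),
     one = (\<lambda>i x. 0, \<lambda>i. 0)\<rparr>"

definition \<delta> :: "nat \<Rightarrow> int \<Rightarrow> int" where
  "\<delta> i x = (if int p * q i dvd x then 1 else 0)"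

definition \<xi> :: "(nat \<Rightarrow> int \<Rightarrow> int) \<times> (nat \<Rightarrow> int)" where
  "\<xi> = (\<delta>, \<lambda>i. 0)"

text \<open>The lattice \<open>A\<^sub>i\<close> is encoded by its numerators: \<open>f i\<close> has period \<open>p\<^bsup>i+3\<^esup>\<close> and represents \<open>0\<close> in \<open>A\<^sub>i\<close> iff it is
  null. Components with \<open>i \<ge> k\<close> are present in \<open>\<Gamma>\<close> but invisible to the digits.\<close>

definition null :: "nat \<Rightarrow> (int \<Rightarrow> int) \<Rightarrow> bool" where
  "null i f \<longleftrightarrow> (\<forall>x y. q i dvd x - y \<longrightarrow> f x = f y)"

definition J :: "(nat \<times> int) set" where
  "J = (SIGMA i:{..<k}. {q i..<int p * q i})"

text \<open>The numbers \<open>f i x - f i (x mod q i)\<close> for \<open>(i, x) \<in> J\<close> are free coordinates of the class of \<open>f\<close> in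
  \<open>\<Oplus>\<^bsub>i<k\<^esub> A\<^sub>i\<close>; all their \<open>l\<close>-th base-\<open>p\<close> digits together form one digit of the completion.\<close>

definition vdigit :: "nat \<Rightarrow> (nat \<Rightarrow> int \<Rightarrow> int) \<Rightarrow> nat \<times> int \<Rightarrow> int" where
  "vdigit l f = restrict (\<lambda>(i, x). (f i x - f i (x mod q i)) div int p ^ l mod int p) J"

text \<open>The entries of a digit sequence are integers, so the digits at all points of
  \<open>J\<close> are packed into one; any injection serves.\<close>

definition enc :: "(nat \<times> int \<Rightarrow> int) \<Rightarrow> int" where
  "enc = (SOME e. inj_on e (J \<rightarrow>\<^sub>E {0..<int p}))"

text \<open>The modulus \<open>p^(k+2)\<close> is a multiple of every period \<open>p * q i\<close>
  with \<open>i < k\<close>, so the residue of a shift amount determines its action. Shifts come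
  before values because the values of a product involve the shift of the left factor.\<close>

definition D :: "nat \<Rightarrow> (nat \<Rightarrow> int \<Rightarrow> int) \<times> (nat \<Rightarrow> int) \<Rightarrow> int" where
  "D n a = (if n < k then snd a n mod int p ^ (k + 2) else enc (vdigit (n - k) (fst a)))"

definition B :: "nat \<Rightarrow> int set" where
  "B n = (if n < k then {0..<int p ^ (k + 2)} else enc ` (J \<rightarrow>\<^sub>E {0..<int p}))"

text \<open>Agreement of \<open>n\<close> digits freed from \<open>enc\<close> and from the base
  points \<open>x mod q i\<close>. For \<open>n \<le> k\<close> the modulus \<open>p^(n - k)\<close>
  is \<open>1\<close> and the second condition is void.\<close>

definition level_cong :: "nat \<Rightarrow> (nat \<Rightarrow> int \<Rightarrow> int) \<times> (nat \<Rightarrow> int) \<Rightarrow> (nat \<Rightarrow> int \<Rightarrow> int) \<times> (nat \<Rightarrow> int) \<Rightarrow> bool" where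
  "level_cong n a b \<longleftrightarrow> (\<forall>i<min n k. [snd a i = snd b i] (mod int p ^ (k + 2))) \<and>
     (\<forall>i<k. \<forall>x y. q i dvd x - y \<longrightarrow>
        [fst a i x - fst a i y = fst b i x - fst b i y] (mod int p ^ (n - k)))"

lemma p_pos: "int p > 0" and p_gt1: "int p > 1"
  using prime_gt_1_nat[OF p] by auto

lemma q_pos: "q i > 0"
  using p_pos by simp

lemma carrier_\<Gamma>: "(f, t) \<in> carrier \<Gamma> \<longleftrightarrow> (\<forall>i x y. int p * q i dvd x - y \<longrightarrow> f i x = f i y)"
  by (simp add: \<Gamma>_def)

lemma carrierD: "a \<in> carrier \<Gamma> \<Longrightarrow> int p * q i dvd x - y \<Longrightarrow> fst a i x = fst a i y"
  by (cases a) (auto simp: carrier_\<Gamma>)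

lemma mult_\<Gamma>: "(f, t) \<otimes>\<^bsub>\<Gamma>\<^esub> (g, s) = (\<lambda>i x. f i x + g i (x - t i), \<lambda>i. t i + s i)"
  by (simp add: \<Gamma>_def)

lemma one_\<Gamma>: "\<one>\<^bsub>\<Gamma>\<^esub> = (\<lambda>i x. 0, \<lambda>i. 0)"
  by (simp add: \<Gamma>_def)

lemma inv_in_\<Gamma>:
  assumes "(f, t) \<in> carrier \<Gamma>"
  shows "(\<lambda>i x. - f i (x + t i), \<lambda>i. - t i) \<in> carrier \<Gamma>"
  unfolding carrier_\<Gamma>
proof (intro allI impI)
  fix i x y assume "int p * q i dvd x - y"
  hence "int p * q i dvd (x + t i) - (y + t i)" by simp
  hence "f i (x + t i) = f i (y + t i)" using assms unfolding carrier_\<Gamma> by blast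
  thus "- f i (x + t i) = - f i (y + t i)" by simp
qed

lemma group_\<Gamma>: "group \<Gamma>"
proof (rule groupI)
  fix a b assume "a \<in> carrier \<Gamma>" "b \<in> carrier \<Gamma>"
  moreover obtain f t g s where ab: "a = (f, t)" "b = (g, s)" by fastforce
  ultimately have f: "(f, t) \<in> carrier \<Gamma>" and g: "(g, s) \<in> carrier \<Gamma>" by auto
  show "a \<otimes>\<^bsub>\<Gamma>\<^esub> b \<in> carrier \<Gamma>"
    unfolding ab mult_\<Gamma> carrier_\<Gamma>
  proof (intro allI impI)
    fix i x y assume *: "int p * q i dvd x - y"
    hence "int p * q i dvd (x - t i) - (y - t i)" by simp
    hence "g i (x - t i) = g i (y - t i)" using g unfolding carrier_\<Gamma> by blast
    moreover have "f i x = f i y" using f * unfolding carrier_\<Gamma> by blast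
    ultimately show "f i x + g i (x - t i) = f i y + g i (y - t i)" by simp
  qed
next
  fix a b c
  show "a \<otimes>\<^bsub>\<Gamma>\<^esub> b \<otimes>\<^bsub>\<Gamma>\<^esub> c = a \<otimes>\<^bsub>\<Gamma>\<^esub> (b \<otimes>\<^bsub>\<Gamma>\<^esub> c)"
    by (cases a; cases b; cases c) (simp add: mult_\<Gamma> add.assoc diff_diff_eq)
next
  fix a assume a: "a \<in> carrier \<Gamma>"
  obtain f t where ft: "a = (f, t)" by fastforce
  show "\<one>\<^bsub>\<Gamma>\<^esub> \<otimes>\<^bsub>\<Gamma>\<^esub> a = a"
    by (simp add: one_\<Gamma> ft mult_\<Gamma>)
  show "\<exists>b\<in>carrier \<Gamma>. b \<otimes>\<^bsub>\<Gamma>\<^esub> a = \<one>\<^bsub>\<Gamma>\<^esub>"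
    by (rule bexI[OF _ inv_in_\<Gamma>[OF a[unfolded ft]]]) (simp add: ft mult_\<Gamma> one_\<Gamma>)
qed (simp add: one_\<Gamma> carrier_\<Gamma>)

sublocale G: group \<Gamma>
  by (rule group_\<Gamma>)

lemma inv_\<Gamma>:
  assumes "(f, t) \<in> carrier \<Gamma>"
  shows "inv\<^bsub>\<Gamma>\<^esub> (f, t) = (\<lambda>i x. - f i (x + t i), \<lambda>i. - t i)"
  using assms by (intro G.inv_equality inv_in_\<Gamma>) (simp_all add: mult_\<Gamma> one_\<Gamma>)

section \<open>The digit expansion of the extension\<close>

lemma finite_J: "finite J"
  by (simp add: J_def)

lemma inj_enc: "inj_on enc (J \<rightarrow>\<^sub>E {0..<int p})"
proof -
  have "finite (J \<rightarrow>\<^sub>E {0..<int p})"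
    by (intro finite_PiE finite_J) auto
  then obtain e :: "(nat \<times> int \<Rightarrow> int) \<Rightarrow> nat" where "inj_on e (J \<rightarrow>\<^sub>E {0..<int p})"
    using finite_imp_inj_to_nat_seg by blast
  hence "inj_on (\<lambda>u. int (e u)) (J \<rightarrow>\<^sub>E {0..<int p})"
    by (auto simp: inj_on_def)
  thus ?thesis unfolding enc_def by (rule someI[where P = "\<lambda>e. inj_on e (J \<rightarrow>\<^sub>E {0..<int p})"])
qed

lemma vdigit_in: "vdigit l f \<in> J \<rightarrow>\<^sub>E {0..<int p}"
  using p_pos by (auto simp: vdigit_def)

lemma D_in: "D n a \<in> B n"
  using p_pos vdigit_in by (auto simp: D_def B_def)

lemma card_B: "\<exists>e. card (B n) = p ^ e"
proof (cases "n < k")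
  case True
  hence "card (B n) = p ^ (k + 2)"
    by (simp add: B_def nat_power_eq del: power_Suc add_2_eq_Suc')
  thus ?thesis by blast
next
  case False
  hence "card (B n) = p ^ card J"
    by (simp add: B_def card_image[OF inj_enc] card_PiE finite_J)
  thus ?thesis by blast
qed

text \<open>By periodicity a point may be taken in \<open>{0..<p * q i}\<close>, where it is its own
  base point or belongs to \<open>J\<close>. Points congruent modulo \<open>q i\<close> share their
  base point, which cancels in the difference.\<close>

lemma vdigits_eq_iff:
  assumes f: "(f, t) \<in> carrier \<Gamma>" and g: "(g, s) \<in> carrier \<Gamma>"
  shows "(\<forall>l<L. vdigit l f = vdigit l g) \<longleftrightarrow>
    (\<forall>i<k. \<forall>x y. q i dvd x - y \<longrightarrow> [f i x - f i y = g i x - g i y] (mod int p ^ L))"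
    (is "?l \<longleftrightarrow> ?r")
proof -
  have "?l \<longleftrightarrow> (\<forall>(i, x)\<in>J. [f i x - f i (x mod q i) = g i x - g i (x mod q i)] (mod int p ^ L))"
    unfolding cong_def mod_power_eq_iff_digits[OF p_pos]
    by (auto simp: vdigit_def fun_eq_iff restrict_def)
  also have "\<dots> \<longleftrightarrow> ?r"
  proof
    assume r: ?r
    show "\<forall>(i, x)\<in>J. [f i x - f i (x mod q i) = g i x - g i (x mod q i)] (mod int p ^ L)"
    proof (clarify)
      fix i x assume "(i, x) \<in> J"
      moreover have "q i dvd x - x mod q i" by (simp only: dvd_minus_mod)
      ultimately show "[f i x - f i (x mod q i) = g i x - g i (x mod q i)] (mod int p ^ L)"
        using r by (auto simp: J_def)
    qed
  next
    assume *: "\<forall>(i, x)\<in>J. [f i x - f i (x mod q i) = g i x - g i (x mod q i)] (mod int p ^ L)"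
    have base: "[f i x - f i (x mod q i) = g i x - g i (x mod q i)] (mod int p ^ L)" if "i < k" for i x
    proof -
      define x' where "x' = x mod (int p * q i)"
      have x'_mod: "x' mod q i = x mod q i"
        unfolding x'_def by (intro mod_mod_cancel) simp
      have "int p * q i dvd x - x'"
        unfolding x'_def by (simp only: dvd_minus_mod)
      hence fg: "f i x = f i x'" "g i x = g i x'"
        using f g unfolding carrier_\<Gamma> by blast+
      have x': "0 \<le> x'" "x' < int p * q i"
        using p_pos q_pos[of i] by (auto simp: x'_def)
      show ?thesis
      proof (cases "x' < q i")
        case True
        hence "x mod q i = x'" using x' x'_mod by simp
        thus ?thesis by (simp add: fg)
      next
        case False
        hence "(i, x') \<in> J" using that x' by (auto simp: J_def)
        thus ?thesis using * x'_mod fg by fastforce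
      qed
    qed
    show ?r
    proof (intro allI impI)
      fix i x y assume i: "i < k" and "q i dvd x - y"
      hence "x mod q i = y mod q i" by (simp add: mod_eq_dvd_iff)
      thus "[f i x - f i y = g i x - g i y] (mod int p ^ L)"
        using cong_diff[OF base[OF i, of x] base[OF i, of y]] by simp
    qed
  qed
  finally show ?thesis .
qed

lemma D_agree_iff:
  assumes "a \<in> carrier \<Gamma>" "b \<in> carrier \<Gamma>"
  shows "(\<forall>i<n. D i a = D i b) \<longleftrightarrow> level_cong n a b"
proof -
  have "(\<forall>i<n. D i a = D i b) \<longleftrightarrow> (\<forall>i<min n k. D i a = D i b) \<and> (\<forall>l<n - k. D (k + l) a = D (k + l) b)"
  proof (intro iffI allI impI conjI)
    fix i assume *: "(\<forall>i<min n k. D i a = D i b) \<and> (\<forall>l<n - k. D (k + l) a = D (k + l) b)" "i < n"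
    show "D i a = D i b"
    proof (cases "i < k")
      case False
      hence "D (k + (i - k)) a = D (k + (i - k)) b" using * by (intro mp[OF spec[OF conjunct2[OF *(1)]]]) auto
      thus ?thesis using False by simp
    qed (use * in auto)
  qed auto
  also have "(\<forall>i<min n k. D i a = D i b) \<longleftrightarrow> (\<forall>i<min n k. [snd a i = snd b i] (mod int p ^ (k + 2)))"
    by (simp add: D_def cong_def)
  also have "(\<forall>l<n - k. D (k + l) a = D (k + l) b) \<longleftrightarrow> (\<forall>l<n - k. vdigit l (fst a) = vdigit l (fst b))"
    using inj_on_eq_iff[OF inj_enc vdigit_in vdigit_in] by (simp add: D_def)
  also have "\<dots> \<longleftrightarrow> (\<forall>i<k. \<forall>x y. q i dvd x - y \<longrightarrow>
        [fst a i x - fst a i y = fst b i x - fst b i y] (mod int p ^ (n - k)))"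
    using assms by (intro vdigits_eq_iff[where t = "snd a" and s = "snd b"]) simp_all
  finally show ?thesis
    unfolding level_cong_def .
qed

lemma period_dvd: "i < k \<Longrightarrow> int p * q i dvd int p ^ (k + 2)"
  using le_imp_power_dvd[of "i + 3" "k + 2" "int p"] by (simp add: numeral_3_eq_3)

text \<open>As soon as a value digit is compared, all \<open>k\<close> shift digits agree, so both
  left factors translate the second function by the same amount modulo its period.\<close>

lemma level_cong_mult:
  assumes "a \<in> carrier \<Gamma>" "a' \<in> carrier \<Gamma>" "b \<in> carrier \<Gamma>" "b' \<in> carrier \<Gamma>" "level_cong n a a'" "level_cong n b b'"
  shows "level_cong n (a \<otimes>\<^bsub>\<Gamma>\<^esub> b) (a' \<otimes>\<^bsub>\<Gamma>\<^esub> b')"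
proof -
  obtain f t f' t' g s g' s' where eqs: "a = (f, t)" "a' = (f', t')" "b = (g, s)" "b' = (g', s')"
    by (metis surj_pair)
  have A: "\<And>i. i < min n k \<Longrightarrow> [t i = t' i] (mod int p ^ (k + 2))"
      "\<And>i x y. i < k \<Longrightarrow> q i dvd x - y \<Longrightarrow> [f i x - f i y = f' i x - f' i y] (mod int p ^ (n - k))"
    and B: "\<And>i. i < min n k \<Longrightarrow> [s i = s' i] (mod int p ^ (k + 2))"
      "\<And>i x y. i < k \<Longrightarrow> q i dvd x - y \<Longrightarrow> [g i x - g i y = g' i x - g' i y] (mod int p ^ (n - k))"
    using assms(5,6) unfolding level_cong_def eqs by simp_all
  show ?thesis
    unfolding level_cong_def eqs mult_\<Gamma> fst_conv snd_conv
  proof (intro conjI allI impI)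
    fix i assume "i < min n k"
    thus "[t i + s i = t' i + s' i] (mod int p ^ (k + 2))"
      using A(1) B(1) by (intro cong_add)
  next
    fix i x y assume i: "i < k" and xy: "q i dvd x - y"
    show "[f i x + g i (x - t i) - (f i y + g i (y - t i)) =
        f' i x + g' i (x - t' i) - (f' i y + g' i (y - t' i))] (mod int p ^ (n - k))"
    proof (cases "n \<le> k")
      case False
      hence "int p ^ (k + 2) dvd t i - t' i"
        using A(1)[of i] i by (simp add: cong_iff_dvd_diff)
      hence "int p * q i dvd t i - t' i"
        using period_dvd[OF i] dvd_trans by blast
      hence "int p * q i dvd (z - t' i) - (z - t i)" for z by simp
      hence g': "g' i (z - t' i) = g' i (z - t i)" for z
        using carrierD[OF assms(4)] by (simp add: eqs)
      have "q i dvd (x - t i) - (y - t i)" using xy by simp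
      from cong_add[OF A(2)[OF i xy] B(2)[OF i this]] show ?thesis
        unfolding g' by (simp add: algebra_simps)
    qed simp
  qed
qed

lemma D_surj:
  assumes s: "\<forall>i. s i \<in> B i"
  shows "\<exists>a\<in>carrier \<Gamma>. \<forall>i<n. D i a = s i"
proof -
  have "s (k + l) \<in> enc ` (J \<rightarrow>\<^sub>E {0..<int p})" for l
    using s[rule_format, of "k + l"] by (simp add: B_def)
  hence "\<forall>l. \<exists>u. u \<in> J \<rightarrow>\<^sub>E {0..<int p} \<and> s (k + l) = enc u"
    by blast
  then obtain u where u: "\<And>l. u l \<in> J \<rightarrow>\<^sub>E {0..<int p}" "\<And>l. s (k + l) = enc (u l)"
    unfolding choice_iff by blast
  have "\<exists>a. \<forall>l<n. a div int p ^ l mod int p = u l z" if "z \<in> J" for z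
    using u(1) that by (intro ex_int_with_digits p_pos) (auto simp: PiE_iff)
  then obtain F where F: "\<And>z l. z \<in> J \<Longrightarrow> l < n \<Longrightarrow> F z div int p ^ l mod int p = u l z"
    by metis
  \<comment> \<open>Zero at the base points and the prescribed integer on \<open>J\<close>,
    continued periodically; the differences that enter the digits are then the prescribed
    integers.\<close>
  define f where "f i x = (let y = x mod (int p * q i) in if y < q i then 0 else F (i, y))" for i x
  have f_in: "(f, s) \<in> carrier \<Gamma>"
    unfolding carrier_\<Gamma>
  proof (intro allI impI)
    fix i x y assume "int p * q i dvd x - y"
    hence "x mod (int p * q i) = y mod (int p * q i)" by (simp only: mod_eq_dvd_iff)
    thus "f i x = f i y" by (simp only: f_def)
  qed
  have "vdigit l f = u l" if "l < n" for l
  proof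
    fix z show "vdigit l f z = u l z"
    proof (cases "z \<in> J")
      case True
      then obtain i x where z: "z = (i, x)" and x: "i < k" "q i \<le> x" "x < int p * q i"
        by (auto simp: J_def)
      have "x mod (int p * q i) = x" using x q_pos[of i] by simp
      hence "f i x = F z" using x by (simp add: f_def z)
      moreover have "x mod q i mod (int p * q i) = x mod q i"
      proof (rule mod_pos_pos_trivial)
        show "0 \<le> x mod q i" using q_pos by simp
        have "x mod q i < q i" using q_pos by simp
        thus "x mod q i < int p * q i" using x by linarith
      qed
      hence "f i (x mod q i) = 0"
        using q_pos[of i] by (simp add: f_def)
      ultimately show ?thesis using True F[OF True that] by (simp add: vdigit_def z)
    next
      case False
      thus ?thesis using PiE_arb[OF u(1)[of l] False] by (simp add: vdigit_def)
    qed
  qed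
  hence "D i (f, s) = s i" if "i < n" for i
    using that s[rule_format, of i] u(2)[of "i - k"] by (auto simp: D_def B_def)
  thus ?thesis using f_in by blast
qed

end

sublocale shift_group \<subseteq> F: digit_filtration \<Gamma> D B p
proof
  show "prime p" by (rule p)
  show "\<exists>e. card (B n) = p ^ e" for n by (rule card_B)
  show "D n a \<in> B n" for a n by (rule D_in)
  show "\<forall>i<n. D i (a \<otimes>\<^bsub>\<Gamma>\<^esub> b) = D i (a' \<otimes>\<^bsub>\<Gamma>\<^esub> b')"
    if "a \<in> carrier \<Gamma>" "a' \<in> carrier \<Gamma>" "b \<in> carrier \<Gamma>" "b' \<in> carrier \<Gamma>"
      "\<forall>i<n. D i a = D i a'" "\<forall>i<n. D i b = D i b'" for a a' b b' n
    using that level_cong_mult by (simp add: D_agree_iff)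
  show "\<exists>a\<in>carrier \<Gamma>. \<forall>i<n. D i a = s i" if "\<forall>i. s i \<in> B i" for s n
    using that by (rule D_surj)
qed

context shift_group
begin

section \<open>Null functions and sums of translates\<close>

lemma agree_iff: "a \<in> carrier \<Gamma> \<Longrightarrow> b \<in> carrier \<Gamma> \<Longrightarrow> F.agree n (F.digits a) (F.digits b) \<longleftrightarrow> level_cong n a b"
  by (simp add: F.agree_def F.digits_def D_agree_iff)

lemma null_add: "null i f \<Longrightarrow> null i g \<Longrightarrow> null i (\<lambda>x. f x + g x)"
  and null_diff: "null i f \<Longrightarrow> null i g \<Longrightarrow> null i (\<lambda>x. f x - g x)"
  and null_mult: "null i f \<Longrightarrow> null i (\<lambda>x. a * f x)"
  unfolding null_def by metis+

lemma null_shift: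
  assumes "null i f"
  shows "null i (\<lambda>x. f (x - a))"
  unfolding null_def
proof (intro allI impI)
  fix x y assume "q i dvd x - y"
  hence "q i dvd (x - a) - (y - a)" by simp
  thus "f (x - a) = f (y - a)" using assms unfolding null_def by blast
qed

lemma null_sum: "(\<And>c. c \<in> I \<Longrightarrow> null i (f c)) \<Longrightarrow> null i (\<lambda>x. \<Sum>c\<in>I. f c x)"
  unfolding null_def by (intro allI impI sum.cong refl) blast

lemma \<delta>_period: "int p * q i dvd x - y \<Longrightarrow> \<delta> i x = \<delta> i y"
  using dvd_diff_commute dvd_add_right_iff[of "int p * q i" "x - y" y] by (simp add: \<delta>_def)

lemma \<xi>_in: "\<xi> \<in> carrier \<Gamma>"
  unfolding \<xi>_def carrier_\<Gamma> using \<delta>_period by blast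

text \<open>A sum over \<open>p\<close> successive translates by \<open>q i * t\<close> is invariant
  under that translation, since \<open>p\<close> of them make a full period. As \<open>t\<close> is
  invertible modulo \<open>p\<close>, repeated translation reaches every multiple of
  \<open>q i\<close> modulo the period.\<close>

lemma null_norm:
  assumes per: "\<And>x y. int p * q i dvd x - y \<Longrightarrow> g x = g y" and t: "\<not> int p dvd t"
  shows "null i (\<lambda>x. \<Sum>c<p. g (x - int c * (q i * t)))"
  unfolding null_def
proof (intro allI impI)
  define h where "h x = (\<Sum>c<p. g (x - int c * (q i * t)))" for x
  have step: "h (x + q i * t) = h x" for x
  proof -
    \<comment> \<open>\<open>h x\<close> and \<open>h (x + q i * t)\<close> sum \<open>G\<close>
      over neighbouring windows of length \<open>p\<close>, and the two end terms lie a full period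
      apart.\<close>
    define G where "G c = g (x + q i * t - int c * (q i * t))" for c
    have "h (x + q i * t) = (\<Sum>c<p. G c)" by (simp add: h_def G_def)
    moreover have "h x = (\<Sum>c<p. G (Suc c))"
      by (simp add: h_def G_def algebra_simps)
    moreover have "(\<Sum>c<p. G (Suc c)) - (\<Sum>c<p. G c) = G p - G 0"
      by (simp only: sum_subtractf[symmetric] sum_lessThan_telescope)
    moreover have "G p = G 0"
      unfolding G_def by (rule per) (simp add: algebra_simps)
    ultimately show ?thesis by simp
  qed
  have steps: "h (x + int n * (q i * t)) = h x" for x n
  proof (induction n)
    case (Suc n)
    have "h (x + int (Suc n) * (q i * t)) = h (x + int n * (q i * t) + q i * t)"
      by (simp add: algebra_simps)
    thus ?case using Suc step by simp
  qed simp
  have hper: "h x = h y" if "int p * q i dvd x - y" for x y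
    unfolding h_def by (intro sum.cong refl per) (use that in simp)
  fix x y assume "q i dvd x - y"
  then obtain r where r: "x - y = q i * r" by (elim dvdE)
  have "coprime t (int p)"
    using t p by (metis coprime_commute prime_imp_coprime prime_nat_int_transfer)
  then obtain u where u: "[t * u = 1] (mod int p)"
    using cong_solve_coprime_int by blast
  \<comment> \<open>Chosen so that \<open>n * t\<close> is congruent to \<open>r\<close> modulo
    \<open>p\<close>: then \<open>n\<close> translations bridge the distance \<open>q i * r\<close>
    up to a period.\<close>
  define n where "n = nat ((u * r) mod int p)"
  have n: "int n = (u * r) mod int p" using p_pos by (simp add: n_def)
  have "[int n * t = u * r * t] (mod int p)"
    unfolding n by (intro cong_mult cong_refl) (simp add: cong_def)
  also have "[u * r * t = 1 * r] (mod int p)"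
    using cong_mult[OF u cong_refl[of r]] by (simp add: ac_simps)
  finally have "int p dvd r - int n * t"
    by (simp add: cong_iff_dvd_diff dvd_diff_commute)
  hence "int p * q i dvd q i * (r - int n * t)"
    by (subst mult.commute, intro mult_dvd_mono) auto
  also have "q i * (r - int n * t) = x - (y + int n * (q i * t))"
    using r by (simp add: algebra_simps)
  finally have "h x = h (y + int n * (q i * t))" by (rule hper)
  thus "(\<Sum>c<p. g (x - int c * (q i * t))) = (\<Sum>c<p. g (y - int c * (q i * t)))"
    using steps by (simp add: h_def)
qed

text \<open>For \<open>t\<close> prime to \<open>p\<close>, the multiples \<open>c * t\<close> run
  exactly once through the residues modulo the period, so a single term survives. Thus the
  translates of \<open>\<delta> i\<close> along multiples of \<open>t\<close> span all functions of
  this period.\<close>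

lemma sum_shifted_\<delta>:
  assumes per: "\<And>x y. int p * q i dvd x - y \<Longrightarrow> F x = F y" and t: "\<not> int p dvd t"
  shows "(\<Sum>c\<in>{0..<int p * q i}. F (c * t) * \<delta> i (x - c * t)) = F x"
proof -
  let ?N = "int p * q i"
  have N: "?N > 0" using p_pos q_pos by simp
  have Np: "?N = int p ^ (i + 3)" by (simp add: numeral_3_eq_3)
  have "coprime (int p) t"
    using t p by (metis prime_imp_coprime prime_nat_int_transfer)
  hence cop: "coprime ?N t"
    unfolding Np by simp
  then obtain u where u: "[t * u = 1] (mod ?N)"
    using cong_solve_coprime_int[of t ?N] by (auto simp: coprime_commute)
  define c0 where "c0 = (u * x) mod ?N"
  have c0: "c0 \<in> {0..<?N}" using N by (simp add: c0_def)
  have "[c0 * t = u * x * t] (mod ?N)"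
    unfolding c0_def by (intro cong_mult cong_refl) (simp add: cong_def)
  also have "[u * x * t = 1 * x] (mod ?N)"
    using cong_mult[OF u cong_refl[of x]] by (simp add: ac_simps)
  finally have c0_dvd: "?N dvd x - c0 * t"
    by (simp add: cong_iff_dvd_diff dvd_diff_commute)
  have uniq: "c = c0" if "c \<in> {0..<?N}" "?N dvd x - c * t" for c
  proof -
    have "?N dvd (c - c0) * t"
      using dvd_diff[OF c0_dvd that(2)] by (simp add: algebra_simps)
    hence "?N dvd c - c0" using cop by (simp only: coprime_dvd_mult_left_iff)
    hence "c mod ?N = c0 mod ?N" by (simp only: mod_eq_dvd_iff)
    thus ?thesis using that(1) c0 by simp
  qed
  have "(\<Sum>c\<in>{0..<?N}. F (c * t) * \<delta> i (x - c * t)) = (\<Sum>c\<in>{0..<?N}. if c = c0 then F x else 0)"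
  proof (intro sum.cong refl)
    fix c assume c: "c \<in> {0..<?N}"
    show "F (c * t) * \<delta> i (x - c * t) = (if c = c0 then F x else 0)"
    proof (cases "c = c0")
      case True
      thus ?thesis using c0_dvd per[OF c0_dvd] by (simp add: \<delta>_def)
    next
      case False
      hence "\<not> ?N dvd x - c * t" using uniq c by blast
      thus ?thesis using False by (simp add: \<delta>_def)
    qed
  qed
  also have "\<dots> = F x" using c0 by simp
  finally show ?thesis .
qed

section \<open>The zero-shift part of the generated subgroup\<close>

context
  fixes w t assumes wt: "(w, t) \<in> carrier \<Gamma>"
begin

text \<open>A module over the integer polynomials in translation by \<open>t\<close>: conjugation by
  \<open>(w, t)\<close> acts on it as this translation, the terms in \<open>w\<close> cancelling.
  All components are translated at once, which is why they have to be separated below.\<close>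

definition S :: "(nat \<Rightarrow> int \<Rightarrow> int) set" where
  "S = {g. (g, \<lambda>i. 0) \<in> generate \<Gamma> {\<xi>, (w, t)}}"

lemma gen_in: "generate \<Gamma> {\<xi>, (w, t)} \<subseteq> carrier \<Gamma>"
  using wt \<xi>_in by (intro G.generate_incl) auto

lemma S_period: "g \<in> S \<Longrightarrow> int p * q i dvd x - y \<Longrightarrow> g i x = g i y"
  using gen_in carrierD[of "(g, \<lambda>i. 0)"] by (auto simp: S_def)

lemma S_\<delta>: "\<delta> \<in> S"
  using generate.incl[of \<xi> "{\<xi>, (w, t)}" \<Gamma>] by (simp add: S_def \<xi>_def)

lemma S_0: "(\<lambda>i x. 0) \<in> S"
  using generate.one[of \<Gamma> "{\<xi>, (w, t)}"] by (simp add: S_def one_\<Gamma>)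

lemma S_add: "f \<in> S \<Longrightarrow> g \<in> S \<Longrightarrow> (\<lambda>i x. f i x + g i x) \<in> S"
  using generate.eng[of "(f, \<lambda>i. 0)" \<Gamma> "{\<xi>, (w, t)}" "(g, \<lambda>i. 0)"] by (simp add: S_def mult_\<Gamma>)

lemma S_neg: "g \<in> S \<Longrightarrow> (\<lambda>i x. - g i x) \<in> S"
  using G.generate_m_inv_closed[of "{\<xi>, (w, t)}" "(g, \<lambda>i. 0)"] inv_\<Gamma>[of g "\<lambda>i. 0"] gen_in wt \<xi>_in
  by (auto simp: S_def)

lemma S_shift1:
  assumes "g \<in> S"
  shows "(\<lambda>i x. g i (x - t i)) \<in> S"
proof -
  let ?A = "{\<xi>, (w, t)}"
  have "(w, t) \<otimes>\<^bsub>\<Gamma>\<^esub> (g, \<lambda>i. 0) \<otimes>\<^bsub>\<Gamma>\<^esub> inv\<^bsub>\<Gamma>\<^esub> (w, t) \<in> generate \<Gamma> ?A"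
    using assms by (intro generate.eng generate.inv) (auto simp: S_def intro: generate.incl)
  also have "(w, t) \<otimes>\<^bsub>\<Gamma>\<^esub> (g, \<lambda>i. 0) \<otimes>\<^bsub>\<Gamma>\<^esub> inv\<^bsub>\<Gamma>\<^esub> (w, t) = (\<lambda>i x. g i (x - t i), \<lambda>i. 0)"
    by (simp add: inv_\<Gamma>[OF wt] mult_\<Gamma>)
  finally show ?thesis by (simp add: S_def)
qed

lemma S_shift: "g \<in> S \<Longrightarrow> (\<lambda>i x. g i (x - int n * t i)) \<in> S"
proof (induction n)
  case (Suc n)
  from S_shift1[OF Suc.IH[OF Suc.prems]] show ?case
    by (simp add: algebra_simps)
qed simp

lemma S_mult:
  assumes "g \<in> S"
  shows "(\<lambda>i x. a * g i x) \<in> S"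
proof -
  have nat: "(\<lambda>i x. int n * g i x) \<in> S" for n
  proof (induction n)
    case (Suc n)
    from S_add[OF assms Suc.IH] show ?case by (simp add: algebra_simps)
  qed (simp add: S_0)
  show ?thesis
  proof (cases "a \<ge> 0")
    case True
    thus ?thesis using nat[of "nat a"] by simp
  next
    case False
    thus ?thesis using S_neg[OF nat[of "nat (- a)"]] by simp
  qed
qed

lemma S_diff: "f \<in> S \<Longrightarrow> g \<in> S \<Longrightarrow> (\<lambda>i x. f i x - g i x) \<in> S"
  using S_add[OF _ S_neg, of f g] by simp

lemma S_sum: "finite I \<Longrightarrow> (\<And>c. c \<in> I \<Longrightarrow> h c \<in> S) \<Longrightarrow> (\<lambda>i x. \<Sum>c\<in>I. h c i x) \<in> S"
proof (induction I rule: finite_induct)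
  case (insert c I)
  hence "(\<lambda>i x. h c i x + (\<Sum>c\<in>I. h c i x)) \<in> S"
    by (intro S_add) auto
  thus ?case using insert.hyps by simp
qed (simp add: S_0)

text \<open>On \<open>A\<^sub>i\<close> the sum \<open>\<Sum>\<^bsub>c<p\<^esub> y\<^bsup>c q j\<^esup>\<close> acts as \<open>p\<close> for \<open>i < j\<close> and as \<open>0\<close> for \<open>i = j\<close>, which separates the
  components of the delta tuple from the top down.\<close>

definition norm_op :: "nat \<Rightarrow> (nat \<Rightarrow> int \<Rightarrow> int) \<Rightarrow> nat \<Rightarrow> int \<Rightarrow> int" where
  "norm_op j g i x = (\<Sum>c<p. g i (x - int c * (q j * t i)))"

lemma S_norm_op:
  assumes "g \<in> S"
  shows "norm_op j g \<in> S"
proof -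
  \<comment> \<open>Translation by \<open>q j * t i\<close> is the \<open>p^(j+2)\<close>-th power
    of translation by \<open>t i\<close>, so \<open>norm_op j\<close> is a polynomial in the
    conjugation action.\<close>
  have "(\<lambda>i x. \<Sum>c<p. g i (x - int (c * p ^ (j + 2)) * t i)) \<in> S"
    by (intro S_sum S_shift assms) auto
  also have "(\<lambda>i x. \<Sum>c<p. g i (x - int (c * p ^ (j + 2)) * t i)) = norm_op j g"
    by (intro ext) (simp only: norm_op_def of_nat_mult of_nat_power mult.assoc)
  finally show ?thesis .
qed

lemma norm_op_low:
  assumes "g \<in> S" "i < j"
  shows "norm_op j g i x = int p * g i x"
proof -
  have "g i (x - int c * (q j * t i)) = g i x" for c
  proof (rule S_period[OF assms(1)])
    have "int p ^ (i + 3) dvd q j" using assms(2) by (intro le_imp_power_dvd) simp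
    hence "int p * q i dvd q j" by (simp add: numeral_3_eq_3)
    thus "int p * q i dvd x - int c * (q j * t i) - x" by simp
  qed
  thus ?thesis by (simp add: norm_op_def)
qed

lemma null_norm_op: "null i (g i) \<Longrightarrow> null i (norm_op j g i)"
  unfolding norm_op_def by (intro null_sum null_shift)

context
  assumes t: "\<And>i. i < k \<Longrightarrow> \<not> int p dvd t i"
begin

lemma null_norm_op_same: "g \<in> S \<Longrightarrow> i < k \<Longrightarrow> null i (norm_op i g i)"
  unfolding norm_op_def using null_norm[of i "g i" "t i"] S_period t by blast

text \<open>Applying \<open>norm_op j\<close> for \<open>j = k - 1, k - 2, ...\<close> kills
  component \<open>j\<close>, keeps the higher ones null and multiplies the lower ones by
  \<open>p\<close>.\<close>

lemma truncated_\<delta>: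
  "d \<le> k \<Longrightarrow> \<exists>g\<in>S. (\<forall>i<k - d. \<forall>x. g i x = int p ^ d * \<delta> i x) \<and> (\<forall>i. k - d \<le> i \<and> i < k \<longrightarrow> null i (g i))"
proof (induction d)
  case 0
  show ?case by (rule bexI[OF _ S_\<delta>]) auto
next
  case (Suc d)
  then obtain g where g: "g \<in> S" "\<And>i x. i < k - d \<Longrightarrow> g i x = int p ^ d * \<delta> i x"
      "\<And>i. k - d \<le> i \<Longrightarrow> i < k \<Longrightarrow> null i (g i)"
    by auto
  define j where "j = k - Suc d"
  have j: "j < k" "k - d = Suc j" using Suc.prems by (auto simp: j_def)
  show ?case
  proof (intro bexI[OF _ S_norm_op[OF g(1), of j]] conjI allI impI)
    fix i x assume "i < k - Suc d"
    hence "i < j" "i < k - d" by (auto simp: j_def)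
    thus "norm_op j g i x = int p ^ Suc d * \<delta> i x"
      using norm_op_low[OF g(1)] g(2) by simp
  next
    fix i assume i: "k - Suc d \<le> i \<and> i < k"
    show "null i (norm_op j g i)"
    proof (cases "i = j")
      case True
      thus ?thesis using null_norm_op_same[OF g(1) j(1)] by simp
    next
      case False
      hence "k - d \<le> i" using i by (auto simp: j_def)
      thus ?thesis using null_norm_op g(3) i by blast
    qed
  qed
qed

lemma isolated_\<delta>:
  assumes j: "j < k"
  shows "\<exists>h\<in>S. null j (\<lambda>x. h j x - int p ^ k * \<delta> j x) \<and> (\<forall>i<k. i \<noteq> j \<longrightarrow> null i (h i))"
proof -
  define d where "d = k - Suc j"
  have d: "d \<le> k" "k - d = Suc j" "Suc d + j = k" using j by (auto simp: d_def)
  obtain g where g: "g \<in> S" "\<And>i x. i < Suc j \<Longrightarrow> g i x = int p ^ d * \<delta> i x"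
      "\<And>i. Suc j \<le> i \<Longrightarrow> i < k \<Longrightarrow> null i (g i)"
    using truncated_\<delta>[OF d(1)] d(2) by auto
  \<comment> \<open>Below \<open>j\<close> the two terms in the bracket cancel, and at
    \<open>j\<close> the norm is null, leaving \<open>p^(Suc d) * \<delta> j\<close>. The factor
    \<open>p^j\<close> raises the coefficient to \<open>p^k\<close>, the same for every
    \<open>j\<close>.\<close>
  define h where "h i x = int p ^ j * (int p * g i x - norm_op j g i x)" for i x
  have "h \<in> S"
    unfolding h_def[abs_def] by (intro S_mult S_diff S_norm_op g(1))
  moreover have "null j (\<lambda>x. h j x - int p ^ k * \<delta> j x)"
  proof -
    have "h j x - int p ^ k * \<delta> j x = (- (int p ^ j)) * norm_op j g j x" for x
      unfolding h_def d(3)[symmetric] using g(2)[of j x] by (simp add: power_add algebra_simps)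
    thus ?thesis
      using null_mult[OF null_norm_op_same[OF g(1) j]] by (simp only:)
  qed
  moreover have "null i (h i)" if "i < k" "i \<noteq> j" for i
  proof (cases "i < j")
    case True
    hence "h i = (\<lambda>x. 0)"
      using norm_op_low[OF g(1) True] by (simp add: h_def fun_eq_iff)
    thus ?thesis by (simp add: null_def)
  next
    case False
    hence "null i (g i)" using g(3) that by simp
    thus ?thesis
      unfolding h_def[abs_def] by (intro null_mult null_diff null_norm_op)
  qed
  ultimately show ?thesis by blast
qed

text \<open>Finite index made explicit: once \<open>p^k * \<delta> j\<close> is isolated in each
  component, every class divisible by \<open>p^k\<close> is an integral combination of
  translates.\<close>

lemma S_contains:
  assumes f: "(f, s) \<in> carrier \<Gamma>"
    and dvd: "\<And>i x y. i < k \<Longrightarrow> q i dvd x - y \<Longrightarrow> int p ^ k dvd f i x - f i y"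
  shows "\<exists>g\<in>S. \<forall>i<k. null i (\<lambda>x. g i x - f i x)"
proof -
  have "\<forall>j. \<exists>h. j < k \<longrightarrow> h \<in> S \<and> null j (\<lambda>x. h j x - int p ^ k * \<delta> j x) \<and> (\<forall>i<k. i \<noteq> j \<longrightarrow> null i (h i))"
    using isolated_\<delta> by blast
  then obtain h where h: "\<And>j. j < k \<Longrightarrow> h j \<in> S" "\<And>j. j < k \<Longrightarrow> null j (\<lambda>x. h j j x - int p ^ k * \<delta> j x)"
      "\<And>i j. j < k \<Longrightarrow> i < k \<Longrightarrow> i \<noteq> j \<Longrightarrow> null i (h j i)"
    by metis
  \<comment> \<open>Subtracting the base-point value alters \<open>f i\<close> by a null function
    only and makes divisibility by \<open>p^k\<close> hold pointwise.\<close>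
  define f' where "f' i x = (f i x - f i (x mod q i)) div int p ^ k" for i x
  have f': "int p ^ k * f' i x = f i x - f i (x mod q i)" if "i < k" for i x
    unfolding f'_def by (intro dvd_mult_div_cancel dvd that) (simp only: dvd_minus_mod)
  have f'_per: "f' i x = f' i y" if xy: "int p * q i dvd x - y" for i x y
  proof -
    have "q i dvd x - y" using xy by (metis dvd_mult_right)
    hence "x mod q i = y mod q i" by (simp only: mod_eq_dvd_iff)
    moreover have "f i x = f i y" using f xy unfolding carrier_\<Gamma> by blast
    ultimately show ?thesis by (simp only: f'_def)
  qed
  \<comment> \<open>By \<open>sum_shifted_\<delta>\<close>, component \<open>j\<close> of
    \<open>G j\<close> is \<open>p^k * f' j\<close> up to a null function. The simultaneous
    translation of the other components does no harm, as \<open>h j\<close> is null there.\<close>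
  define G where "G j i x = (\<Sum>c\<in>{0..<int p * q j}. f' j (c * t j) * h j i (x - c * t i))" for j i x
  have GS: "G j \<in> S" if "j < k" for j
  proof -
    have "(\<lambda>i x. \<Sum>c\<in>{0..<int p * q j}. f' j (c * t j) * h j i (x - int (nat c) * t i)) \<in> S"
      by (intro S_sum S_mult S_shift h that) simp
    also have "(\<lambda>i x. \<Sum>c\<in>{0..<int p * q j}. f' j (c * t j) * h j i (x - int (nat c) * t i)) = G j"
      by (intro ext) (simp add: G_def)
    finally show ?thesis .
  qed
  have G_off: "null i (G j i)" if "j < k" "i < k" "i \<noteq> j" for i j
    unfolding G_def by (intro null_sum null_mult null_shift h(3) that)
  have G_on: "null i (\<lambda>x. G i i x - f i x)" if i: "i < k" for i
  proof -
    have "G i i x - f i x = (\<Sum>c\<in>{0..<int p * q i}. f' i (c * t i) * (h i i (x - c * t i) - int p ^ k * \<delta> i (x - c * t i)))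
        - f i (x mod q i)" for x
    proof -
      have "(\<Sum>c\<in>{0..<int p * q i}. f' i (c * t i) * (int p ^ k * \<delta> i (x - c * t i))) = int p ^ k * f' i x"
        using sum_shifted_\<delta>[of i "f' i" "t i" x] f'_per t[OF i]
        by (simp add: sum_distrib_left[symmetric] mult.left_commute)
      thus ?thesis
        using f'[OF i, of x] by (simp add: G_def right_diff_distrib sum_subtractf)
    qed
    moreover have "null i (\<lambda>x. f i (x mod q i))"
      unfolding null_def by (metis mod_eq_dvd_iff)
    ultimately show ?thesis
      using null_diff[OF null_sum[OF null_mult[OF null_shift[OF h(2)[OF i]]]]] by simp
  qed
  define g where "g i x = (\<Sum>j<k. G j i x)" for i x
  have "g \<in> S"
    unfolding g_def[abs_def] by (intro S_sum GS) auto
  moreover have "null i (\<lambda>x. g i x - f i x)" if i: "i < k" for i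
  proof -
    have "g i x - f i x = (\<Sum>j\<in>{..<k} - {i}. G j i x) + (G i i x - f i x)" for x
      using i by (simp add: g_def sum.remove[of "{..<k}" i])
    moreover have "null i (\<lambda>x. (\<Sum>j\<in>{..<k} - {i}. G j i x) + (G i i x - f i x))"
      by (intro null_add null_sum G_on G_off i) auto
    ultimately show ?thesis by (simp only:)
  qed
  ultimately show ?thesis by blast
qed

end

end

section \<open>Shifts divisible by the prime\<close>

lemma snd_int_pow: "a \<in> carrier \<Gamma> \<Longrightarrow> snd (a [^]\<^bsub>\<Gamma>\<^esub> (e::int)) i = e * snd a i"
proof -
  assume a: "a \<in> carrier \<Gamma>"
  have snd_mult: "snd (b \<otimes>\<^bsub>\<Gamma>\<^esub> c) i = snd b i + snd c i" for b c
    by (cases b; cases c) (simp add: mult_\<Gamma>)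
  have nat: "snd (a [^]\<^bsub>\<Gamma>\<^esub> (n::nat)) i = int n * snd a i" for n
    by (induction n) (simp_all add: snd_mult one_\<Gamma> algebra_simps)
  have inv: "snd (inv\<^bsub>\<Gamma>\<^esub> b) i = - snd b i" if "b \<in> carrier \<Gamma>" for b
    using that by (cases b) (simp add: inv_\<Gamma>)
  show ?thesis
    using a by (cases e rule: int_cases2) (simp_all add: int_pow_int G.int_pow_neg inv nat)
qed

text \<open>A shift by a multiple of the period acts trivially on component \<open>i\<close>, so
  powers become multiples there.\<close>

lemma fst_int_pow:
  assumes a: "a \<in> carrier \<Gamma>" and per: "int p * q i dvd snd a i"
  shows "fst (a [^]\<^bsub>\<Gamma>\<^esub> (e::int)) i x = e * fst a i x"
proof -
  have fst_mult: "fst (b \<otimes>\<^bsub>\<Gamma>\<^esub> a) i x = fst b i x + fst a i x"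
    if "b \<in> carrier \<Gamma>" "int p * q i dvd snd b i" for b
  proof -
    have "fst a i (x - snd b i) = fst a i x"
      by (rule carrierD[OF a]) (use that(2) in simp)
    thus ?thesis by (cases a; cases b) (simp add: mult_\<Gamma>)
  qed
  have nat: "fst (a [^]\<^bsub>\<Gamma>\<^esub> (n::nat)) i x = int n * fst a i x" for n
  proof (induction n)
    case (Suc n)
    have "snd (a [^]\<^bsub>\<Gamma>\<^esub> n) i = int n * snd a i"
      using snd_int_pow[OF a, of "int n"] by (simp add: int_pow_int)
    hence "int p * q i dvd snd (a [^]\<^bsub>\<Gamma>\<^esub> n) i" using per by simp
    thus ?case using Suc a by (simp add: fst_mult algebra_simps)
  qed (simp add: one_\<Gamma>)
  have inv: "fst (inv\<^bsub>\<Gamma>\<^esub> b) i x = - fst b i x" if b: "b \<in> carrier \<Gamma>" "int p * q i dvd snd b i" for b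
  proof -
    have "fst b i (x + snd b i) = fst b i x"
      by (rule carrierD[OF b(1)]) (use b(2) in simp)
    thus ?thesis using b(1) by (cases b) (simp add: inv_\<Gamma>)
  qed
  show ?thesis
  proof (cases e rule: int_cases2)
    case (nonneg n)
    thus ?thesis using nat by (simp add: int_pow_int)
  next
    case (nonpos n)
    have "int p * q i dvd snd (a [^]\<^bsub>\<Gamma>\<^esub> n) i"
      using snd_int_pow[OF a, of "int n"] per by (simp add: int_pow_int)
    thus ?thesis using nonpos a by (simp add: G.int_pow_neg int_pow_int inv nat)
  qed
qed

text \<open>Shifts divisible by \<open>p\<close> preserve the residue class of \<open>1\<close>
  modulo \<open>p\<close>, on which \<open>\<delta> i\<close> vanishes. Restricted to this class,
  \<open>\<xi>\<close> acts like the identity and a word reduces to \<open>\<gamma>\<close> raised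
  to its total exponent.\<close>

lemma generated_like_power:
  assumes \<gamma>: "\<gamma> \<in> carrier \<Gamma>" "int p dvd snd \<gamma> i" and "\<eta> \<in> generate \<Gamma> {\<xi>, \<gamma>}"
  shows "\<exists>e::int. snd \<eta> i = snd (\<gamma> [^]\<^bsub>\<Gamma>\<^esub> e) i \<and>
    (\<forall>x. [x = 1] (mod int p) \<longrightarrow> fst \<eta> i x = fst (\<gamma> [^]\<^bsub>\<Gamma>\<^esub> e) i x)"
  using assms(3)
proof (induction rule: generate.induct)
  have \<delta>0: "\<delta> i x = 0" if "[x = 1] (mod int p)" for x
  proof -
    have "\<not> int p dvd x"
    proof
      assume "int p dvd x"
      hence "int p dvd 1" using that cong_dvd_iff by blast
      thus False using p_gt1 by simp
    qed
    thus ?thesis by (metis \<delta>_def dvd_mult_left)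
  qed
  {
    case one
    show ?case by (rule exI[of _ 0]) simp
  next
    case (incl h)
    then consider "h = \<xi>" | "h = \<gamma>" by blast
    thus ?case
    proof cases
      case 1
      thus ?thesis using \<delta>0 by (intro exI[of _ 0]) (simp add: \<xi>_def one_\<Gamma>)
    next
      case 2
      thus ?thesis using \<gamma>(1) by (intro exI[of _ 1]) (simp add: G.int_pow_1)
    qed
  next
    case (inv h)
    then consider "h = \<xi>" | "h = \<gamma>" by blast
    thus ?case
    proof cases
      case 1
      have "inv\<^bsub>\<Gamma>\<^esub> \<xi> = (\<lambda>i x. - \<delta> i x, \<lambda>i. 0)"
        using inv_\<Gamma>[of \<delta> "\<lambda>i. 0"] \<xi>_in by (simp add: \<xi>_def)
      thus ?thesis using 1 \<delta>0 by (intro exI[of _ 0]) (simp add: one_\<Gamma>)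
    next
      case 2
      thus ?thesis using \<gamma>(1) by (intro exI[of _ "- 1"]) (simp add: G.int_pow_neg G.int_pow_1)
    qed
  next
    case (eng a b)
    then obtain c d :: int where c: "snd a i = snd (\<gamma> [^]\<^bsub>\<Gamma>\<^esub> c) i"
        "\<And>x. [x = 1] (mod int p) \<Longrightarrow> fst a i x = fst (\<gamma> [^]\<^bsub>\<Gamma>\<^esub> c) i x"
      and d: "snd b i = snd (\<gamma> [^]\<^bsub>\<Gamma>\<^esub> d) i"
        "\<And>x. [x = 1] (mod int p) \<Longrightarrow> fst b i x = fst (\<gamma> [^]\<^bsub>\<Gamma>\<^esub> d) i x"
      by blast
    have snd_mult: "snd (b \<otimes>\<^bsub>\<Gamma>\<^esub> c) i = snd b i + snd c i" for b c
      by (cases b; cases c) (simp add: mult_\<Gamma>)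
    have fst_mult: "fst (b \<otimes>\<^bsub>\<Gamma>\<^esub> c) i x = fst b i x + fst c i (x - snd b i)" for b c x
      by (cases b; cases c) (simp add: mult_\<Gamma>)
    have "int p dvd snd a i"
      using c(1) \<gamma> by (simp add: snd_int_pow)
    hence shift: "[x - snd a i = 1] (mod int p)" if "[x = 1] (mod int p)" for x
      using cong_diff[OF that, of "snd a i" 0] by (simp add: cong_0_iff)
    show ?case
      using \<gamma>(1) c d shift
      by (intro exI[of _ "c + d"]) (simp add: G.int_pow_mult snd_mult fst_mult)
  }
qed

text \<open>A rank argument. If \<open>p^m\<close> times the delta functions at \<open>1\<close> and
  \<open>1 + p\<close> could both be approximated, the approximants would be powers of
  \<open>\<gamma>\<close> on the class of \<open>1\<close> and have proportional function parts.
  Their matrix of differences at these two points would be \<open>- p^m\<close> times the identity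
  modulo \<open>p^(m+1)\<close>, whose determinant is nonzero.\<close>

lemma not_all_generated:
  assumes \<gamma>: "\<gamma> \<in> carrier \<Gamma>" and i: "i < k" "int p dvd snd \<gamma> i"
  shows "\<exists>\<sigma>\<in>carrier \<Gamma>. level_cong m \<sigma> \<one>\<^bsub>\<Gamma>\<^esub> \<and> (\<forall>\<eta>\<in>generate \<Gamma> {\<xi>, \<gamma>}. \<not> level_cong (k + m + 1) \<eta> \<sigma>)"
proof (rule ccontr)
  assume contra: "\<not> ?thesis"
  let ?M = "int p ^ (m + 1)"
  \<comment> \<open>The factor \<open>p^m\<close> makes these trivial to \<open>m\<close> digits,
    while level \<open>k + m + 1\<close> compares values modulo \<open>p^(m+1)\<close>, where
    \<open>p^m\<close> is still visible.\<close>
  define \<sigma> where "\<sigma> y = ((\<lambda>j x. int p ^ m * \<delta> j (x - y)), (\<lambda>j::nat. 0::int))" for y :: int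
  have \<sigma>_in: "\<sigma> y \<in> carrier \<Gamma>" for y
    unfolding \<sigma>_def carrier_\<Gamma> using \<delta>_period by simp
  have "level_cong m (\<sigma> y) \<one>\<^bsub>\<Gamma>\<^esub>" for y
    by (auto simp: level_cong_def \<sigma>_def one_\<Gamma> cong_0_iff right_diff_distrib[symmetric] le_imp_power_dvd)
  hence "\<exists>\<eta>\<in>generate \<Gamma> {\<xi>, \<gamma>}. level_cong (k + m + 1) \<eta> (\<sigma> y)" for y
    using contra \<sigma>_in by blast
  then obtain \<eta> where \<eta>: "\<And>y. \<eta> y \<in> generate \<Gamma> {\<xi>, \<gamma>}" "\<And>y. level_cong (k + m + 1) (\<eta> y) (\<sigma> y)"
    by metis
  obtain e where e: "\<And>y. snd (\<eta> y) i = snd (\<gamma> [^]\<^bsub>\<Gamma>\<^esub> (e y :: int)) i"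
      "\<And>y x. [x = 1] (mod int p) \<Longrightarrow> fst (\<eta> y) i x = fst (\<gamma> [^]\<^bsub>\<Gamma>\<^esub> e y) i x"
    using generated_like_power[OF \<gamma> i(2) \<eta>(1)] by metis
  define F where "F y = fst (\<gamma> [^]\<^bsub>\<Gamma>\<^esub> e y) i" for y
  have pow_in: "\<gamma> [^]\<^bsub>\<Gamma>\<^esub> e y \<in> carrier \<Gamma>" for y
    using \<gamma> by simp
  have per: "int p * q i dvd snd (\<gamma> [^]\<^bsub>\<Gamma>\<^esub> e y) i" for y
  proof -
    have "[snd (\<eta> y) i = 0] (mod int p ^ (k + 2))"
      using \<eta>(2)[of y] i(1) by (simp add: level_cong_def \<sigma>_def)
    thus ?thesis using period_dvd[OF i(1)] dvd_trans e(1) by (simp only: cong_0_iff) blast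
  qed
  \<comment> \<open>Both sides are the function part of \<open>\<gamma>\<close> to the power
    \<open>e y * e z\<close>, because powers of either approximant are multiples by
    \<open>per\<close>.\<close>
  have comm: "e z * F y x = e y * F z x" for x y z
  proof -
    have "e z * F y x = fst (\<gamma> [^]\<^bsub>\<Gamma>\<^esub> (e y * e z)) i x"
      unfolding F_def fst_int_pow[OF pow_in per, symmetric] using \<gamma> by (simp add: G.int_pow_pow)
    also have "\<dots> = e y * F z x"
      unfolding F_def fst_int_pow[OF pow_in per, symmetric] using \<gamma> by (simp add: G.int_pow_pow mult.commute)
    finally show ?thesis .
  qed
  have q1: "[x + q i = 1] (mod int p)" if "[x = 1] (mod int p)" for x
    using cong_add[OF that, of "q i" 0] by (simp add: cong_0_iff)
  \<comment> \<open>Digits see functions only modulo null ones, hence only differences along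
    multiples of \<open>q i\<close>.\<close>
  define d where "d y x = F y (x + q i) - F y x" for y x
  have d_cong: "[d y x = int p ^ m * (\<delta> i (x + q i - y) - \<delta> i (x - y))] (mod ?M)"
    if "[x = 1] (mod int p)" for x y
  proof -
    have "[fst (\<eta> y) i (x + q i) - fst (\<eta> y) i x = fst (\<sigma> y) i (x + q i) - fst (\<sigma> y) i x] (mod ?M)"
      using \<eta>(2)[of y] i(1) unfolding level_cong_def by simp
    thus ?thesis
      using e(2) q1 that by (simp add: d_def F_def \<sigma>_def right_diff_distrib)
  qed
  have d_comm: "e z * d y x = e y * d z x" for x y z
    using comm by (simp add: d_def right_diff_distrib)
  \<comment> \<open>Both lie in the class of \<open>1\<close> modulo \<open>p\<close>, yet they
    differ modulo \<open>q i\<close>, as \<open>p^2\<close> divides \<open>q i\<close>.\<close>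
  let ?a = "1::int" and ?b = "1 + int p"
  have ab: "[?a = 1] (mod int p)" "[?b = 1] (mod int p)"
    by (simp_all add: cong_def)
  have \<delta>q: "\<delta> i (q i) = 0"
    using p_gt1 q_pos[of i] by (auto simp: \<delta>_def dest!: zdvd_imp_le)
  have \<delta>_small: "\<delta> i (q i * c + int p) = 0" "\<delta> i (q i * c - int p) = 0" for c
  proof -
    have "\<not> q i dvd int p"
    proof
      assume "q i dvd int p"
      moreover have "int p ^ 2 dvd q i" by (rule le_imp_power_dvd) simp
      ultimately have "int p ^ 2 dvd int p" using dvd_trans by blast
      hence "int p ^ 2 \<le> int p" using p_pos zdvd_imp_le by blast
      thus False using p_gt1 by (simp add: power2_eq_square)
    qed
    hence "\<not> q i dvd q i * c + int p" "\<not> q i dvd q i * c - int p"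
      by (simp_all only: dvd_add_right_iff dvd_diff_right_iff dvd_triv_left not_False_eq_True)
    thus "\<delta> i (q i * c + int p) = 0" "\<delta> i (q i * c - int p) = 0"
      unfolding \<delta>_def using dvd_mult_right by metis+
  qed
  have \<delta>1: "\<delta> i 0 = 1" by (simp add: \<delta>_def)
  have aa: "[d ?a ?a = - (int p ^ m)] (mod ?M)"
    using d_cong[OF ab(1), of ?a] by (simp add: \<delta>q \<delta>1 del: power_Suc add_2_eq_Suc')
  have bb: "[d ?b ?b = - (int p ^ m)] (mod ?M)"
    using d_cong[OF ab(2), of ?b] by (simp add: \<delta>q \<delta>1 del: power_Suc add_2_eq_Suc')
  have a_b: "[d ?a ?b = 0] (mod ?M)"
    using d_cong[OF ab(2), of ?a] \<delta>_small(1)[of 1] \<delta>_small(1)[of 0] by (simp add: add.commute)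
  have b_a: "[d ?b ?a = 0] (mod ?M)"
    using d_cong[OF ab(1), of ?b] \<delta>_small(2)[of 1] \<delta>_small(2)[of 0] by simp
  have pm: "\<exists>A. c = int p ^ m * A \<and> \<not> int p dvd A" if c: "[c = - (int p ^ m)] (mod ?M)" for c
  proof -
    obtain r where "c - - (int p ^ m) = ?M * r"
      using c unfolding cong_iff_dvd_diff by (elim dvdE)
    hence "c = int p ^ m * (int p * r - 1)" by (simp add: algebra_simps)
    moreover have "\<not> int p dvd int p * r - 1"
    proof
      assume "int p dvd int p * r - 1"
      hence "int p dvd 1" by (metis dvd_diff_right_iff dvd_triv_left)
      thus False using p_gt1 by simp
    qed
    ultimately show ?thesis by blast
  qed
  obtain A where A: "d ?a ?a = int p ^ m * A" "\<not> int p dvd A" using pm[OF aa] by blast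
  obtain C where C: "d ?b ?b = int p ^ m * C" "\<not> int p dvd C" using pm[OF bb] by blast
  obtain r where r: "d ?a ?b = ?M * r" using a_b by (auto simp: cong_0_iff elim: dvdE)
  obtain r' where r': "d ?b ?a = ?M * r'" using b_a by (auto simp: cong_0_iff elim: dvdE)
  have d0: "d y x = 0" if "e y = 0" for x y
    using that by (simp add: d_def F_def one_\<Gamma>)
  have "A \<noteq> 0" "C \<noteq> 0" using A C by auto
  hence "e ?a \<noteq> 0" "e ?b \<noteq> 0"
    using d0[of ?a ?a] d0[of ?b ?b] A(1) C(1) p_pos by auto
  \<comment> \<open>Multiplying the two proportionality relations and cancelling the nonzero
    exponents makes the determinant vanish. But the diagonal product has exactly
    \<open>2 * m\<close> factors \<open>p\<close>, while the other product has at least two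
    more.\<close>
  moreover have "(e ?b * d ?a ?a) * (e ?a * d ?b ?b) = (e ?a * d ?b ?a) * (e ?b * d ?a ?b)"
    using d_comm[of ?b ?a ?a] d_comm[of ?a ?b ?b] by simp
  ultimately have "d ?a ?a * d ?b ?b = d ?b ?a * d ?a ?b"
    by simp
  hence "int p ^ m * int p ^ m * (A * C) = int p ^ m * int p ^ m * (int p * (int p * (r * r')))"
    unfolding A C r r' by (simp add: ac_simps)
  hence "A * C = int p * (int p * (r * r'))"
    using p_pos by simp
  hence "int p dvd A * C" by simp
  moreover have "prime (int p)" using p by simp
  ultimately show False using A C prime_dvd_mult_iff by blast
qed

section \<open>The openizer and its measure\<close>

lemma openizer_eq:
  "openizer F.cgroup F.ctop (F.digits \<xi>) = {y \<in> F.seqs. \<forall>i<k. \<not> int p dvd y i}"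
proof (intro equalityI subsetI)
  fix y assume "y \<in> openizer F.cgroup F.ctop (F.digits \<xi>)"
  then obtain m where y: "y \<in> F.seqs" and m: "\<And>n \<gamma> \<sigma>. \<gamma> \<in> carrier \<Gamma> \<Longrightarrow> F.agree n (F.digits \<gamma>) y \<Longrightarrow>
      \<sigma> \<in> carrier \<Gamma> \<Longrightarrow> F.agree m (F.digits \<sigma>) (F.digits \<one>\<^bsub>\<Gamma>\<^esub>) \<Longrightarrow>
      \<exists>\<eta>\<in>generate \<Gamma> {\<xi>, \<gamma>}. F.agree n (F.digits \<eta>) (F.digits \<sigma>)"
    unfolding F.openizer_iff[OF \<xi>_in] by blast
  have "\<not> int p dvd y i" if i: "i < k" for i
  proof
    assume "int p dvd y i"
    define \<gamma> where "\<gamma> = F.rep (k + m + 1) y"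
    have \<gamma>: "\<gamma> \<in> carrier \<Gamma>" "F.agree (k + m + 1) (F.digits \<gamma>) y"
      unfolding \<gamma>_def using F.rep[OF y] by auto
    have "D i \<gamma> = y i"
      using \<gamma>(2) i by (simp add: F.agree_def F.digits_def)
    hence "snd \<gamma> i mod int p ^ (k + 2) = y i"
      using i by (simp only: D_def if_True)
    hence "int p dvd snd \<gamma> i"
      using \<open>int p dvd y i\<close> dvd_mod_iff[of "int p" "int p ^ (k + 2)" "snd \<gamma> i"] by simp
    then obtain \<sigma> where \<sigma>: "\<sigma> \<in> carrier \<Gamma>" "level_cong m \<sigma> \<one>\<^bsub>\<Gamma>\<^esub>"
        "\<And>\<eta>. \<eta> \<in> generate \<Gamma> {\<xi>, \<gamma>} \<Longrightarrow> \<not> level_cong (k + m + 1) \<eta> \<sigma>"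
      using not_all_generated[OF \<gamma>(1) i, of m] by blast
    obtain \<eta> where \<eta>: "\<eta> \<in> generate \<Gamma> {\<xi>, \<gamma>}" "F.agree (k + m + 1) (F.digits \<eta>) (F.digits \<sigma>)"
      using m[OF \<gamma> \<sigma>(1)] \<sigma>(1,2) by (auto simp: agree_iff)
    have "\<eta> \<in> carrier \<Gamma>" using \<eta>(1) G.generate_incl[of "{\<xi>, \<gamma>}"] \<xi>_in \<gamma>(1) by blast
    thus False using \<sigma> \<eta> by (simp add: agree_iff)
  qed
  thus "y \<in> {y \<in> F.seqs. \<forall>i<k. \<not> int p dvd y i}" using y by blast
next
  fix y assume "y \<in> {y \<in> F.seqs. \<forall>i<k. \<not> int p dvd y i}"
  hence y: "y \<in> F.seqs" "\<And>i. i < k \<Longrightarrow> \<not> int p dvd y i" by auto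
  have "\<exists>\<eta>\<in>generate \<Gamma> {\<xi>, \<gamma>}. F.agree n (F.digits \<eta>) (F.digits \<sigma>)"
    if \<gamma>: "\<gamma> \<in> carrier \<Gamma>" "F.agree n (F.digits \<gamma>) y"
      \<comment> \<open>The first \<open>k\<close> digits force the shifts to vanish modulo
        \<open>p^(k+2)\<close>; the next \<open>k\<close> force divisibility by \<open>p^k\<close>,
        as \<open>S_contains\<close> requires.\<close>
      and \<sigma>: "\<sigma> \<in> carrier \<Gamma>" "F.agree (k + k) (F.digits \<sigma>) (F.digits \<one>\<^bsub>\<Gamma>\<^esub>)" for n \<gamma> \<sigma>
  proof (cases "n \<le> k + k")
    case True
    show ?thesis
      by (rule bexI[of _ "\<one>\<^bsub>\<Gamma>\<^esub>"]) (rule F.agree_sym[OF F.agree_mono[OF \<sigma>(2) True]], rule generate.one)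
  next
    case False
    obtain w t where wt: "\<gamma> = (w, t)" by fastforce
    obtain f s where fs: "\<sigma> = (f, s)" by fastforce
    have t: "\<not> int p dvd t i" if i: "i < k" for i
    proof -
      have "D i \<gamma> = y i"
        using \<gamma>(2) i False by (simp add: F.agree_def F.digits_def)
      hence "t i mod int p ^ (k + 2) = y i"
        using i by (simp only: D_def if_True wt snd_conv)
      thus ?thesis
        using y(2)[OF i] dvd_mod_iff[of "int p" "int p ^ (k + 2)" "t i"] by simp
    qed
    have "level_cong (k + k) (f, s) \<one>\<^bsub>\<Gamma>\<^esub>"
      using \<sigma> by (simp add: agree_iff fs)
    hence s: "\<And>i. i < k \<Longrightarrow> [s i = 0] (mod int p ^ (k + 2))"
      and f: "\<And>i x y. i < k \<Longrightarrow> q i dvd x - y \<Longrightarrow> int p ^ k dvd f i x - f i y"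
      by (simp_all add: level_cong_def one_\<Gamma> cong_0_iff)
    obtain g where g: "(g, \<lambda>i. 0) \<in> generate \<Gamma> {\<xi>, \<gamma>}" "\<And>i. i < k \<Longrightarrow> null i (\<lambda>x. g i x - f i x)"
      using S_contains[OF \<gamma>(1)[unfolded wt] t \<sigma>(1)[unfolded fs] f] unfolding S_def[OF \<gamma>(1)[unfolded wt]] wt
      by blast
    \<comment> \<open>The zero shift of \<open>g\<close> matches \<open>s\<close>, and
      \<open>g\<close> differs from \<open>f\<close> by null functions, which no digit detects; so
      the agreement holds at every level.\<close>
    have "level_cong n (g, \<lambda>i. 0) (f, s)"
      unfolding level_cong_def fst_conv snd_conv
    proof (intro conjI allI impI)
      fix i assume "i < min n k"
      thus "[0 = s i] (mod int p ^ (k + 2))" by (intro cong_sym[OF s]) simp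
    next
      fix i x y assume "i < k" "q i dvd x - y"
      hence "g i x - f i x = g i y - f i y"
        using g(2) unfolding null_def by blast
      hence "g i x - g i y = f i x - f i y" by simp
      thus "[g i x - g i y = f i x - f i y] (mod int p ^ (n - k))" by simp
    qed
    moreover have "(g, \<lambda>i. 0) \<in> carrier \<Gamma>"
      using g(1) G.generate_incl[of "{\<xi>, \<gamma>}"] \<xi>_in \<gamma>(1) by blast
    ultimately show ?thesis
      using g(1) \<sigma>(1) by (intro bexI[OF _ g(1)]) (simp add: agree_iff fs)
  qed
  thus "y \<in> openizer F.cgroup F.ctop (F.digits \<xi>)"
    unfolding F.openizer_iff[OF \<xi>_in] using y(1) by blast
qed

text \<open>The openizer imposes independent conditions on the first \<open>k\<close> digits, each
  excluding the multiples of \<open>p\<close>, a proportion \<open>1 / p\<close> of the residues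
  modulo \<open>p^(k+2)\<close>.\<close>

lemma measure_openizer:
  "measure F.cmeas (openizer F.cgroup F.ctop (F.digits \<xi>)) = (1 - 1 / real p) ^ k"
proof -
  let ?M = "int p ^ (k + 1)" and ?N = "int p ^ (k + 2)"
  define U where "U = {a \<in> {0..<?N}. \<not> int p dvd a}"
  have U_sub: "U \<subseteq> {0..<?N}"
    by (auto simp: U_def)
  have card_N: "card {0..<?N} = p ^ (k + 2)"
    by (simp add: nat_power_eq del: power_Suc add_2_eq_Suc')
  have "{0..<?N} - U = (\<lambda>b. int p * b) ` {0..<?M}"
    using p_pos by (auto simp: U_def elim!: dvdE simp: zero_le_mult_iff)
  moreover have "card ((\<lambda>b. int p * b) ` {0..<?M}) = p ^ (k + 1)"
    using p_pos by (subst card_image) (auto simp: inj_on_def nat_power_eq simp del: power_Suc)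
  ultimately have "card ({0..<?N} - U) = p ^ (k + 1)"
    by (simp only:)
  moreover have "card {0..<?N} = card U + card ({0..<?N} - U)"
    by (rule card_Int_Diff[of "{0..<?N}" U, unfolded Int_absorb1[OF U_sub]]) simp
  ultimately have "p ^ (k + 2) = card U + p ^ (k + 1)"
    by (simp only: card_N)
  hence "real p ^ (k + 2) = real (card U) + real p ^ (k + 1)"
    by (metis of_nat_add of_nat_power)
  hence "real (card U) = real p ^ (k + 2) - real p ^ (k + 1)"
    by linarith
  hence ratio: "real (card U) / real (card {0..<?N}) = 1 - 1 / real p"
    using p_pos by (simp add: card_N field_simps)
  have "openizer F.cgroup F.ctop (F.digits \<xi>) = {y \<in> F.seqs. \<forall>i\<in>{..<k}. y i \<in> U}"
    unfolding openizer_eq by (auto simp: U_def F.seqs_def B_def)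
  hence "measure F.cmeas (openizer F.cgroup F.ctop (F.digits \<xi>)) =
      (\<Prod>i\<in>{..<k}. real (card U) / real (card (B i)))"
    by (simp only:) (rule F.measure_box, auto simp: U_def B_def)
  also have "\<dots> = (\<Prod>i\<in>{..<k}. 1 - 1 / real p)"
    by (intro prod.cong refl) (simp only: ratio B_def lessThan_iff if_True)
  finally show ?thesis by simp
qed

end

theorem proposition5:
  fixes p :: nat and \<epsilon> :: real
  assumes "prime p" and "\<epsilon> > 0"
  shows "\<exists>(G :: (nat \<Rightarrow> int) monoid) T M x.
           pro_p_group G T p \<and> normalised_haar_measure G T M \<and> x \<in> carrier G \<and>
           0 < measure M (openizer G T x) \<and> measure M (openizer G T x) < \<epsilon>"
proof -
  have p: "real p > 1" using prime_gt_1_nat[OF assms(1)] by simp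
  hence r: "0 < 1 - 1 / real p" "1 - 1 / real p < 1" by (simp_all add: field_simps)
  \<comment> \<open>The number \<open>k\<close> of lattices is chosen so large that the measure
    \<open>(1 - 1 / p)^k\<close> drops below \<open>\<epsilon>\<close>.\<close>
  then obtain k where k: "(1 - 1 / real p) ^ k < \<epsilon>"
    using real_arch_pow_inv[OF assms(2)] by blast
  interpret shift_group p k
    by unfold_locales (rule assms(1))
  show ?thesis
  proof (intro exI conjI)
    show "pro_p_group F.cgroup F.ctop p" by (rule F.pro_p_group_cgroup)
    show "normalised_haar_measure F.cgroup F.ctop F.cmeas" by (rule F.haar_cmeas)
    show "F.digits \<xi> \<in> carrier F.cgroup"
      using F.digits_in[OF \<xi>_in] by simp
    show "0 < measure F.cmeas (openizer F.cgroup F.ctop (F.digits \<xi>))"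
      unfolding measure_openizer using r by simp
    show "measure F.cmeas (openizer F.cgroup F.ctop (F.digits \<xi>)) < \<epsilon>"
      unfolding measure_openizer by (rule k)
  qed
qed

end
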